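(* Let $F$ be a field of characteristic $0$, let $\gamma\in F$, $\gamma\neq 0$, and let $\mathbb{M}=\mathbb{M}_\gamma$ be the 5-dimensional solvable Malcev algebra over $F$ with basis $a,b,c,d,e$ and nonzero brackets (up to anticommutativity) $[b,c]=2d$, $[a,b]=-b$, $[a,c]=-c$, $[a,d]=d$, $[a,e]=\gamma e$. Then for all nonnegative integers $i,j,k,l,m,r,n,p,q,s$, in $U(\mathbb{M})$ the product $(a^ib^jc^kd^le^m)(a^rb^nc^pd^qe^s)$ equals $$\sum_{\alpha=0}^{\min(j,k)}\sum_{\beta=0}^{\alpha}\sum_{\kappa=0}^{i}\sum_{\delta=0}^{i-\kappa}\sum_{\epsilon=0}^{i-\kappa-\delta}\sum_{\zeta=0}^{i-\kappa-\delta-\epsilon}\sum_{\eta=0}^{j-\alpha-\epsilon}\sum_{\theta=0}^{j-\alpha-\epsilon-\eta}\sum_{\lambda=0}^{k-\alpha-\delta}\sum_{\mu=0}^{k-\alpha-\delta-\lambda}\sum_{\nu=0}^{r}$$ $$(-1)^{i+j+k+\alpha-\beta-\kappa-\epsilon-\eta-\theta-\lambda}(\alpha-\beta)^\zeta\,\alpha!\binom{\alpha}{\beta}(\delta+\epsilon)!\;\omega^\nu\binom{i}{\kappa,\zeta}\left\{\begin{matrix} i-\kappa-\zeta\\ \delta+\epsilon\end{matrix}\right\}$$ $$\times\binom{j}{\alpha,\epsilon,\eta,\theta}\binom{k}{\alpha,\delta,\lambda,\mu}\binom{r}{\nu}\left[\begin{matrix} n\\ k-\alpha-\lambda\end{matrix}\right]\left[\begin{matrix}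 p+\lambda\\ j-\alpha-\eta\end{matrix}\right]$$ $$\times\; a^{r+\kappa-\nu}\,b^{-k+n+\alpha+\eta+\lambda}\,c^{-j+p+\alpha+\eta+\lambda}\,d^{\,j+k+l+q-\alpha-\eta-\lambda}\,e^{m+s},$$ where $\omega=j+k-l-2\alpha-\beta-2\delta-2\epsilon-2\theta-2\mu-m\gamma$.
   Context: A Malcev algebra is an anticommutative algebra $(M,[\cdot,\cdot])$ with $J(x,y,[x,z])=[J(x,y,z),x]$, where $J(x,y,z)=[[x,y],z]+[[y,z],x]+[[z,x],y]$. In a nonassociative algebra, $(x,y,z)=(xy)z-x(yz)$. The universal nonassociative enveloping algebra of a Malcev algebra $M$ is $U(M)=F(M)/R(M)$, where $F(M)$ is the unital free nonassociative algebra on a basis of $M$ and $R(M)$ is the ideal generated by $st-ts-[s,t]$, $(s,x,y)+(x,s,y)$, $(x,s,y)+(x,y,s)$ for all $s,t\in M$, $x,y\in F(M)$; $M$ embeds in $U(M)$ and is identified with its image. For the ordered basis $a<b<c<d<e$, $a^ib^jc^kd^le^m$ denotes the left-tapped monomial $a(a(\cdots(b(\cdots(c(\cdots(d(\cdots(e\,e)\cdots)$ with $i$ factors $a$, then $j$ factors $b$, and so on, bracketed from the right; these monomials form an $F$-basis of $U(\mathbb{M})$. Notation: $\binom{n}{k_1,\dots,k_t}=\frac{n!}{k_1!\cdots k_t!\,(n-k_1-\cdots-k_t)!}$ is the multinomial coefficient. $\left\{\begin{matrix} r\\ s\end{matrix}\right\}=\frac{1}{s!}\sum_{t=0}^s(-1)^{s-t}\binom{s}{t}t^r$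 is the Stirling number of the second kind (with $0^0=1$). $\left[\begin{matrix} n\\ t\end{matrix}\right]=n(n-1)\cdots(n-t+1)$ is the falling factorial, equal to $1$ for $t=0$ and to $0$ for $t>n$; terms with such a zero coefficient are $0$, so no negative exponents occur. Sums whose upper limit is negative are empty. For $(\alpha-\beta)^\zeta$ and $\omega^\nu$ one sets $0^0=1$. *)

theory Defs
  imports "HOL-Algebra.QuotRing" "HOL-Algebra.Module" "HOL-Library.Poly_Mapping"
    "HOL-Combinatorics.Stirling"
begin

section \<open>Vector spaces with a distinguished basis\<close>

text \<open>The vector space over \<open>'f\<close> with basis \<open>'x\<close> is the type \<open>'x \<Rightarrow>\<^sub>0 'f\<close> of finitely
  supported functions; the basis vector of \<open>x\<close> is \<open>Poly_Mapping.single x 1\<close>.\<close>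

definition scal :: "'f \<Rightarrow> ('x \<Rightarrow>\<^sub>0 'f) \<Rightarrow> ('x \<Rightarrow>\<^sub>0 'f::field)" where
  "scal c p = Poly_Mapping.map (\<lambda>y. c * y) p"

definition lin_ext :: "('x \<Rightarrow> 'y \<Rightarrow>\<^sub>0 'f) \<Rightarrow> ('x \<Rightarrow>\<^sub>0 'f) \<Rightarrow> ('y \<Rightarrow>\<^sub>0 'f::field)" where
  "lin_ext T p = (\<Sum>u\<in>Poly_Mapping.keys p. scal (Poly_Mapping.lookup p u) (T u))"

definition bilin_ext ::
  "('x \<Rightarrow> 'x \<Rightarrow> 'y \<Rightarrow>\<^sub>0 'f) \<Rightarrow> ('x \<Rightarrow>\<^sub>0 'f) \<Rightarrow> ('x \<Rightarrow>\<^sub>0 'f) \<Rightarrow> ('y \<Rightarrow>\<^sub>0 'f::field)" where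
  "bilin_ext T p q = (\<Sum>u\<in>Poly_Mapping.keys p. \<Sum>v\<in>Poly_Mapping.keys q.
     scal (Poly_Mapping.lookup p u * Poly_Mapping.lookup q v) (T u v))"

lemma lookup_scal [simp]: "Poly_Mapping.lookup (scal c p) z = c * Poly_Mapping.lookup p z"
  by (auto simp: scal_def map.rep_eq when_def)


section \<open>Malcev algebras\<close>

definition jacobian :: "('m::ab_group_add \<Rightarrow> 'm \<Rightarrow> 'm) \<Rightarrow> 'm \<Rightarrow> 'm \<Rightarrow> 'm \<Rightarrow> 'm" where
  "jacobian br x y z = br (br x y) z + br (br y z) x + br (br z x) y"

definition malcev :: "(('x \<Rightarrow>\<^sub>0 'f::field) \<Rightarrow> ('x \<Rightarrow>\<^sub>0 'f) \<Rightarrow> ('x \<Rightarrow>\<^sub>0 'f)) \<Rightarrow> bool" where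
  "malcev br \<longleftrightarrow>
     (\<forall>x y z. br (x + y) z = br x z + br y z \<and> br x (y + z) = br x y + br x z) \<and>
     (\<forall>c x y. br (scal c x) y = scal c (br x y) \<and> br x (scal c y) = scal c (br x y)) \<and>
     (\<forall>x. br x x = 0) \<and>
     (\<forall>x y z. jacobian br x y (br x z) = br (jacobian br x y z) x)"


section \<open>The universal nonassociative enveloping algebra\<close>

subsection \<open>The unital free nonassociative algebra\<close>

text \<open>Its basis is the free unital magma: \<open>None\<close> is the unit, and \<open>Some t\<close> is a nonempty
  nonassociative word.\<close>

datatype 'x word = Gen 'x | Node "'x word" "'x word"

fun magma_mult :: "'x word option \<Rightarrow> 'x word option \<Rightarrow> 'x word option" where
  "magma_mult None v = v"
| "magma_mult u None = u"
| "magma_mult (Some s) (Some t) = Some (Node s t)"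

type_synonym ('x, 'f) free_alg = "'x word option \<Rightarrow>\<^sub>0 'f"

definition fmul :: "('x, 'f::field) free_alg \<Rightarrow> ('x, 'f) free_alg \<Rightarrow> ('x, 'f) free_alg" where
  "fmul = bilin_ext (\<lambda>u v. Poly_Mapping.single (magma_mult u v) 1)"

text \<open>The records of HOL-Algebra are used only as signatures: multiplication is not associative,
  so the locales \<open>ring\<close> and \<open>ideal\<close> do not apply.\<close>

definition free_nonassoc :: "('x, 'f::field) free_alg ring" where
  "free_nonassoc = \<lparr>carrier = UNIV, mult = fmul, one = Poly_Mapping.single None 1,
     zero = 0, add = (+)\<rparr>"

definition associator ::
  "('x, 'f::field) free_alg \<Rightarrow> ('x, 'f) free_alg \<Rightarrow> ('x, 'f) free_alg \<Rightarrow> ('x, 'f) free_alg" where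
  "associator x y z = fmul (fmul x y) z - fmul x (fmul y z)"

definition two_sided_ideal :: "('x, 'f::field) free_alg set \<Rightarrow> bool" where
  "two_sided_ideal I \<longleftrightarrow> 0 \<in> I \<and> (\<forall>x\<in>I. \<forall>y\<in>I. x + y \<in> I) \<and> (\<forall>c. \<forall>x\<in>I. scal c x \<in> I) \<and>
     (\<forall>x. \<forall>y\<in>I. fmul x y \<in> I \<and> fmul y x \<in> I)"

definition ideal_generated :: "('x, 'f::field) free_alg set \<Rightarrow> ('x, 'f) free_alg set" where
  "ideal_generated S = \<Inter>{I. two_sided_ideal I \<and> S \<subseteq> I}"


subsection \<open>The quotient $U(M) = F(M)/R(M)$\<close>

text \<open>\<open>M\<close> is given by its bracket on the vector space with basis \<open>'x\<close>.\<close>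

definition emb :: "('x \<Rightarrow>\<^sub>0 'f) \<Rightarrow> ('x, 'f::field) free_alg" where
  "emb = lin_ext (\<lambda>x. Poly_Mapping.single (Some (Gen x)) 1)"

definition env_ideal ::
  "(('x \<Rightarrow>\<^sub>0 'f::field) \<Rightarrow> ('x \<Rightarrow>\<^sub>0 'f) \<Rightarrow> ('x \<Rightarrow>\<^sub>0 'f)) \<Rightarrow> ('x, 'f) free_alg set" where
  "env_ideal br = ideal_generated
     ({fmul (emb s) (emb t) - fmul (emb t) (emb s) - emb (br s t) | s t. True}
      \<union> {associator (emb s) x y + associator x (emb s) y | s x y. True}
      \<union> {associator x (emb s) y + associator x y (emb s) | s x y. True})"

definition env ::
  "(('x \<Rightarrow>\<^sub>0 'f::field) \<Rightarrow> ('x \<Rightarrow>\<^sub>0 'f) \<Rightarrow> ('x \<Rightarrow>\<^sub>0 'f)) \<Rightarrow> ('f, ('x, 'f) free_alg set) module" where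
  "env br = ring.extend (free_nonassoc Quot env_ideal br)
     \<lparr>smult = \<lambda>c A. \<Union>x\<in>A. env_ideal br +>\<^bsub>free_nonassoc\<^esub> scal c x\<rparr>"

text \<open>The canonical map $M \to U(M)$.\<close>

definition env_incl ::
  "(('x \<Rightarrow>\<^sub>0 'f::field) \<Rightarrow> ('x \<Rightarrow>\<^sub>0 'f) \<Rightarrow> ('x \<Rightarrow>\<^sub>0 'f)) \<Rightarrow> ('x \<Rightarrow>\<^sub>0 'f) \<Rightarrow> ('x, 'f) free_alg set" where
  "env_incl br s = env_ideal br +>\<^bsub>free_nonassoc\<^esub> emb s"


section \<open>The algebra $\mathbb{M}_\gamma$ and its left-tapped monomials\<close>

datatype gen = ga | gb | gc | gd | ge

abbreviation basis_vec :: "gen \<Rightarrow> gen \<Rightarrow>\<^sub>0 'f::field" where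
  "basis_vec x \<equiv> Poly_Mapping.single x 1"

fun M_table :: "'f::field \<Rightarrow> gen \<Rightarrow> gen \<Rightarrow> gen \<Rightarrow>\<^sub>0 'f" where
  "M_table \<gamma> gb gc = scal 2 (basis_vec gd)"
| "M_table \<gamma> gc gb = - scal 2 (basis_vec gd)"
| "M_table \<gamma> ga gb = - basis_vec gb"
| "M_table \<gamma> gb ga = basis_vec gb"
| "M_table \<gamma> ga gc = - basis_vec gc"
| "M_table \<gamma> gc ga = basis_vec gc"
| "M_table \<gamma> ga gd = basis_vec gd"
| "M_table \<gamma> gd ga = - basis_vec gd"
| "M_table \<gamma> ga ge = scal \<gamma> (basis_vec ge)"
| "M_table \<gamma> ge ga = - scal \<gamma> (basis_vec ge)"
| "M_table \<gamma> _ _ = 0"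

definition M_bracket :: "'f::field \<Rightarrow> (gen \<Rightarrow>\<^sub>0 'f) \<Rightarrow> (gen \<Rightarrow>\<^sub>0 'f) \<Rightarrow> (gen \<Rightarrow>\<^sub>0 'f)" where
  "M_bracket \<gamma> = bilin_ext (M_table \<gamma>)"

abbreviation UM :: "'f::field \<Rightarrow> ('f, (gen, 'f) free_alg set) module" where
  "UM \<gamma> \<equiv> env (M_bracket \<gamma>)"

definition left_mult_gen ::
  "'f::field \<Rightarrow> gen \<Rightarrow> (gen, 'f) free_alg set \<Rightarrow> (gen, 'f) free_alg set" where
  "left_mult_gen \<gamma> x u = env_incl (M_bracket \<gamma>) (basis_vec x) \<otimes>\<^bsub>UM \<gamma>\<^esub> u"

text \<open>The innermost factor is written as a product with the unit, so that the case of all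
  exponents zero is included.\<close>

definition left_tapped ::
  "'f::field \<Rightarrow> nat \<Rightarrow> nat \<Rightarrow> nat \<Rightarrow> nat \<Rightarrow> nat \<Rightarrow> (gen, 'f) free_alg set" where
  "left_tapped \<gamma> i j k l m =
     (left_mult_gen \<gamma> ga ^^ i) ((left_mult_gen \<gamma> gb ^^ j) ((left_mult_gen \<gamma> gc ^^ k)
       ((left_mult_gen \<gamma> gd ^^ l) ((left_mult_gen \<gamma> ge ^^ m) \<one>\<^bsub>UM \<gamma>\<^esub>))))"


section \<open>Coefficients\<close>

definition multinomial :: "nat \<Rightarrow> nat list \<Rightarrow> 'f::field_char_0" where
  "multinomial n ks = fact n / (prod_list (map fact ks) * fact (n - sum_list ks))"

definition falling_factorial :: "nat \<Rightarrow> nat \<Rightarrow> 'f::field_char_0" where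
  "falling_factorial n t = (\<Prod>u<t. of_nat n - of_nat u)"


section \<open>Consistency checks\<close>

lemma falling_factorial_zero: "n < t \<Longrightarrow> falling_factorial n t = 0"
  by (auto simp: falling_factorial_def)

text \<open>The library's \<^const>\<open>Stirling\<close> is given by the explicit formula.\<close>

lemma Stirling_explicit_aux:
  "(fact s * of_nat (Stirling r s) :: 'f::field_char_0) =
     (\<Sum>t\<le>s. (-1) ^ (s - t) * of_nat (s choose t) * of_nat t ^ r)"
proof (induction r arbitrary: s)
  case 0
  have "(\<Sum>t\<le>s. (-1) ^ (s - t) * of_nat (s choose t)) = (1 + (-1) :: 'f) ^ s"
    by (subst binomial_ring) (auto intro!: sum.cong)
  then show ?case by (cases s) auto
next
  case (Suc r)
  show ?case
  proof (cases s)
    case 0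
    then show ?thesis by simp
  next
    case s: (Suc s')
    let ?f = "\<lambda>r s t. (-1) ^ (s - t) * of_nat (s choose t) * (of_nat t ^ r :: 'f)"
    have "(fact s * of_nat (Stirling (Suc r) s) :: 'f)
        = of_nat s * (fact s * of_nat (Stirling r s)) + of_nat s * (fact s' * of_nat (Stirling r s'))"
      by (simp add: s algebra_simps)
    also have "\<dots> = of_nat s * ((\<Sum>t\<le>s. ?f r s t) + (\<Sum>t\<le>s'. ?f r s' t))"
      by (simp only: Suc.IH distrib_left)
    also have "(\<Sum>t\<le>s. ?f r s t) = ?f r s 0 + (\<Sum>t\<le>s'. ?f r s (Suc t))"
      unfolding s by (rule sum.atMost_Suc_shift)
    also have "(\<Sum>t\<le>s'. ?f r s' t) = (\<Sum>t\<le>s. ?f r s' t)"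
      by (simp add: s)
    also have "\<dots> = ?f r s' 0 + (\<Sum>t\<le>s'. ?f r s' (Suc t))"
      unfolding s by (rule sum.atMost_Suc_shift)
    also have "of_nat s * (?f r s 0 + (\<Sum>t\<le>s'. ?f r s (Suc t)) + (?f r s' 0 + (\<Sum>t\<le>s'. ?f r s' (Suc t))))
        = (\<Sum>t\<le>s'. of_nat s * (?f r s (Suc t) + ?f r s' (Suc t)))"
      by (simp add: s sum.distrib sum_distrib_left algebra_simps)
    also have "\<dots> = (\<Sum>t\<le>s'. ?f (Suc r) s (Suc t))"
    proof (rule sum.cong)
      fix t assume t: "t \<in> {..s'}"
      have sg: "(of_nat (s' choose Suc t) * (-1) ^ (s' - Suc t) :: 'f)
          = - of_nat (s' choose Suc t) * (-1) ^ (s' - t)"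
      proof (cases "t = s'")
        case False
        with t have "s' - t = Suc (s' - Suc t)" by auto
        then show ?thesis by simp
      qed simp
      have "?f r s (Suc t) + ?f r s' (Suc t)
          = (-1) ^ (s' - t) * of_nat (s' choose t) * of_nat (Suc t) ^ r"
        using sg by (simp add: s algebra_simps)
      moreover have "(of_nat s * of_nat (s' choose t) :: 'f) = of_nat (s choose Suc t) * of_nat (Suc t)"
        unfolding s of_nat_mult[symmetric] by (simp only: Suc_times_binomial_eq)
      ultimately show "of_nat s * (?f r s (Suc t) + ?f r s' (Suc t)) = ?f (Suc r) s (Suc t)"
        by (simp add: s mult.assoc mult.left_commute del: of_nat_Suc binomial_Suc_Suc)
    qed simp
    also have "\<dots> = (\<Sum>t\<le>s. ?f (Suc r) s t)"
      unfolding s by (subst sum.atMost_Suc_shift) simp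
    finally show ?thesis .
  qed
qed

lemma Stirling_explicit:
  "(of_nat (Stirling r s) :: 'f::field_char_0) =
     1 / fact s * (\<Sum>t=0..s. (-1) ^ (s - t) * of_nat (s choose t) * of_nat t ^ r)"
proof -
  have "(of_nat (Stirling r s) :: 'f) = fact s * of_nat (Stirling r s) / fact s" by simp
  then show ?thesis
    by (simp only: Stirling_explicit_aux atLeast0AtMost) simp
qed

lemma UNIV_gen: "(UNIV :: gen set) = {ga, gb, gc, gd, ge}"
  using gen.exhaust by blast

lemma lookup_sum: "Poly_Mapping.lookup (sum f A) z = (\<Sum>x\<in>A. Poly_Mapping.lookup (f x) z)"
  by (induction A rule: infinite_finite_induct) (auto simp: lookup_add)

lemma lookup_bilin_ext_gen:
  fixes p q :: "gen \<Rightarrow>\<^sub>0 'f::field"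
  shows "Poly_Mapping.lookup (bilin_ext T p q) z =
    (\<Sum>u\<in>{ga, gb, gc, gd, ge}. \<Sum>v\<in>{ga, gb, gc, gd, ge}.
      Poly_Mapping.lookup p u * Poly_Mapping.lookup q v * Poly_Mapping.lookup (T u v) z)"
proof -
  have fin: "finite (UNIV :: gen set)" by (simp add: UNIV_gen)
  have "Poly_Mapping.lookup (bilin_ext T p q) z =
    (\<Sum>u\<in>Poly_Mapping.keys p. \<Sum>v\<in>UNIV.
      Poly_Mapping.lookup p u * Poly_Mapping.lookup q v * Poly_Mapping.lookup (T u v) z)"
    unfolding bilin_ext_def lookup_sum lookup_scal
    by (rule sum.cong[OF refl], rule sum.mono_neutral_left)
       (auto simp: fin in_keys_iff)
  also have "\<dots> = (\<Sum>u\<in>UNIV. \<Sum>v\<in>UNIV.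
      Poly_Mapping.lookup p u * Poly_Mapping.lookup q v * Poly_Mapping.lookup (T u v) z)"
    by (intro sum.mono_neutral_left) (auto simp: fin in_keys_iff)
  finally show ?thesis by (simp only: UNIV_gen)
qed

lemma lookup_M_bracket:
  fixes p q :: "gen \<Rightarrow>\<^sub>0 'f::field"
  defines "x \<equiv> Poly_Mapping.lookup p" and "y \<equiv> Poly_Mapping.lookup q"
  shows
    "Poly_Mapping.lookup (M_bracket \<gamma> p q) ga = 0"
    "Poly_Mapping.lookup (M_bracket \<gamma> p q) gb = x gb * y ga - x ga * y gb"
    "Poly_Mapping.lookup (M_bracket \<gamma> p q) gc = x gc * y ga - x ga * y gc"
    "Poly_Mapping.lookup (M_bracket \<gamma> p q) gd =
       2 * (x gb * y gc - x gc * y gb) + x ga * y gd - x gd * y ga"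
    "Poly_Mapping.lookup (M_bracket \<gamma> p q) ge = \<gamma> * (x ga * y ge - x ge * y ga)"
  by (simp_all add: M_bracket_def lookup_bilin_ext_gen x_def y_def lookup_single
      algebra_simps)

lemma gen_vec_eqI:
  assumes "Poly_Mapping.lookup p ga = Poly_Mapping.lookup q ga"
    "Poly_Mapping.lookup p gb = Poly_Mapping.lookup q gb"
    "Poly_Mapping.lookup p gc = Poly_Mapping.lookup q gc"
    "Poly_Mapping.lookup p gd = Poly_Mapping.lookup q gd"
    "Poly_Mapping.lookup p ge = Poly_Mapping.lookup q ge"
  shows "p = q"
proof (rule poly_mapping_eqI)
  fix z show "Poly_Mapping.lookup p z = Poly_Mapping.lookup q z"
    using assms by (cases z) auto
qed

lemma malcev_M_bracket: "malcev (M_bracket \<gamma>)"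
  unfolding malcev_def jacobian_def
proof (intro conjI allI)
  fix x y z
  show "M_bracket \<gamma> (x + y) z = M_bracket \<gamma> x z + M_bracket \<gamma> y z"
    by (rule gen_vec_eqI; simp add: lookup_M_bracket lookup_add algebra_simps)
  show "M_bracket \<gamma> x (y + z) = M_bracket \<gamma> x y + M_bracket \<gamma> x z"
    by (rule gen_vec_eqI; simp add: lookup_M_bracket lookup_add algebra_simps)
  show "M_bracket \<gamma> x x = 0"
    by (rule gen_vec_eqI; simp add: lookup_M_bracket)
  show "M_bracket \<gamma> (scal c x) y = scal c (M_bracket \<gamma> x y)"
    "M_bracket \<gamma> x (scal c y) = scal c (M_bracket \<gamma> x y)" for c
    by (rule gen_vec_eqI; simp add: lookup_M_bracket algebra_simps)+
  let ?b = "M_bracket \<gamma>"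
  show "?b (?b x y) (?b x z) + ?b (?b y (?b x z)) x + ?b (?b (?b x z) x) y
      = ?b (?b (?b x y) z + ?b (?b y z) x + ?b (?b z x) y) x"
    by (rule gen_vec_eqI; simp add: lookup_M_bracket lookup_add ring_distribs; simp add: algebra_simps)
qed

end

theory Submission
  imports Defs "HOL.Vector_Spaces"
begin

text \<open>Write \<open>(x, y, z) = (x y) z - x (y z)\<close>. In \<open>U(M)\<close> every \<open>s\<close> in \<open>M\<close> satisfies
\<open>(s, x, y) = - (x, s, y) = (x, y, s)\<close>. Read as an identity between the operators of left and right
multiplication, this says \<open>L(s x) = L(s) L(x) + [R(s), L(x)]\<close>. Hence left multiplication by
a left-tapped monomial arises from the identity by iterating the maps \<open>X \<mapsto> L(s) X + [R(s), X]\<close>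
for \<open>s = e, d, c, b, a\<close>, and the theorem becomes a calculation in the associative algebra generated by the
operators \<open>L(s)\<close> and \<open>R(s)\<close>. The calculation has two halves.

\<^emph>\<open>Relations.\<close> Put \<open>C(s, t) = [L(s), R(t)] = [R(s), L(t)]\<close>. Then
\<open>[L(s), L(t)] = L([s, t]) - 2 C(s, t)\<close> and \<open>[R(s), R(t)] = - R([s, t]) - 2 C(s, t)\<close>, and the Jacobi
identity for commutators forces \<open>[C(s, t), L(u)] = L(J(s, t, u)) / 6 - C([s, t], u)\<close>
(\<open>jacobi_consequence\<close>). In \<open>\<bbbM>\<close> the Jacobian is alternating with \<open>J(a, b, c) = - 6 d\<close> and vanishes on the
other basis triples. An operator that kills the unit, commutes with \<open>L(b), \<dots>, L(e)\<close> and satisfies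
\<open>[T, L(a)] = t T\<close> for a scalar \<open>t\<close> is zero, because words in the \<open>L(s)\<close> applied to the unit span the algebra
(\<open>vanish_on_generators\<close>). This gives \<open>C(s, t) = 0\<close> for basis vectors, up to order of the arguments, except for
\<open>C(b, c) = L(d) - R(d)\<close>, \<open>P = C(a, b)\<close> and \<open>Q = C(a, c)\<close>, and all commutators of these operators with
the \<open>L\<close> and with \<open>R(a)\<close>.

\<^emph>\<open>Action.\<close> Think of the left-tapped monomials as monomials in commuting variables and let \<open>S\<close> be the shift
\<open>f(a) \<mapsto> f(a + 1)\<close>. The relations yield
\<open>L(a) = a\<close>, \<open>R(d) = d\<close>, \<open>L(d) = d S\<^sup>-\<^sup>1\<close>, \<open>L(e) = e S\<^sup>-\<^sup>\<gamma>\<close>, \<open>P = - d \<partial>c S\<^sup>-\<^sup>1\<close>, \<open>Q = d \<partial>b S\<^sup>-\<^sup>1\<close>,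
\<open>L(b) = b S + d \<partial>c (S\<^sup>-\<^sup>1 - S)\<close> and \<open>L(c) = c S - d \<partial>b (S\<^sup>-\<^sup>1 + S)\<close>.

Each summation index of the formula records one expansion.
\<^item> Iterating \<open>X \<mapsto> L(b) X + [R(b), X]\<close> on \<open>L(c)\<^sup>k L(d)\<^sup>l L(e)\<^sup>m\<close> replaces \<open>\<alpha>\<close> factors \<open>L(c)\<close> by
  \<open>[R(b), L(c)] = L(d) - R(d)\<close>; the binomial expansion of \<open>(L(d) - R(d))\<^sup>\<alpha>\<close> has index \<open>\<beta>\<close>.
\<^item> In the iteration for \<open>a\<close>, \<open>\<kappa>\<close> counts the factors \<open>L(a)\<close>. The derivation \<open>[R(a), -]\<close> multiplies
  \<open>R(d)\<^sup>\<alpha>\<^sup>-\<^sup>\<beta>\<close> by \<open>- (\<alpha> - \<beta>)\<close>, and \<open>\<zeta>\<close> counts how often it hits this factor. Since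
  \<open>[R(a), L(b)] = P\<close> and \<open>[R(a), P] = - P\<close>, its flow maps \<open>L(b)\<close> to \<open>L(b) + (1 - exp(-t)) P\<close>, and similarly
  \<open>L(c)\<close> to \<open>L(c) + (1 - exp(-t)) Q\<close>. The powers of \<open>1 - exp(-t)\<close> are generating functions of Stirling numbers, and
  \<open>\<epsilon>, \<delta>\<close> count the factors \<open>P\<close> and \<open>Q\<close>.
\<^item> The trinomial expansions of the powers of \<open>L(b)\<close> and \<open>L(c)\<close> have indices \<open>\<eta>, \<theta>\<close> and \<open>\<lambda>, \<mu>\<close>, and the
  derivatives \<open>\<partial>b, \<partial>c\<close> leave the falling factorials.
\<^item> All shifts together turn \<open>a\<^sup>r\<close> into \<open>(a + \<omega>)\<^sup>r\<close>, which is expanded with index \<open>\<nu>\<close>.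

So that these are equations in a type, \<open>U(M)\<close> is modelled on the free algebra itself with the product
\<open>p(x y)\<close>, where \<open>p\<close> is a linear projection whose kernel is the ideal \<open>R(M)\<close>
(\<open>env_alg_reduce\<close>). Passing to cosets gives the stated formula.\<close>

section \<open>The ring of linear operators\<close>

lemma scal_add_right: "scal c (u + v) = scal c u + scal c v"
  and scal_add_left: "scal (c + c') u = scal c u + scal c' u"
  and scal_scal: "scal c (scal c' u) = scal (c * c') u"
  and scal_one: "scal 1 u = u"
  and scal_zero_left: "scal 0 u = 0"
  and scal_zero_right: "scal c 0 = 0"
  and scal_minus_right: "scal c (- u) = - scal c u"
  and scal_minus_left: "scal (- c) u = - scal c u"
  and scal_diff_right: "scal c (u - v) = scal c u - scal c v"
  by (rule poly_mapping_eqI; simp add: lookup_add lookup_minus algebra_simps)+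

text \<open>As a type, the linear operators are an instance of \<^class>\<open>ring_1\<close>, so that commutators can be computed by the simplifier. The
scalars are embedded as the central operators \<open>sc c\<close>.\<close>

typedef (overloaded) ('x, 'f::field) lin_op =
  "{T :: ('x \<Rightarrow>\<^sub>0 'f) \<Rightarrow> ('x \<Rightarrow>\<^sub>0 'f).
      (\<forall>u v. T (u + v) = T u + T v) \<and> (\<forall>c u. T (scal c u) = scal c (T u))}"
  morphisms app Lin_op
  by (rule exI[of _ "\<lambda>_. 0"]) (simp add: scal_zero_right)

setup_lifting type_definition_lin_op

lemma app_add: "app T (u + v) = app T u + app T v"
  and app_scal: "app T (scal c u) = scal c (app T u)"
  using app[of T] by auto

lemma lin_op_eqI: "(\<And>u. app S u = app T u) \<Longrightarrow> S = T"
  by (simp add: app_inject[symmetric] fun_eq_iff)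

instantiation lin_op :: (type, field) ring_1
begin

lift_definition zero_lin_op :: "('a, 'b) lin_op" is "\<lambda>_. 0" by (simp add: scal_zero_right)
lift_definition one_lin_op :: "('a, 'b) lin_op" is "\<lambda>u. u" by simp
lift_definition plus_lin_op :: "('a, 'b) lin_op \<Rightarrow> ('a, 'b) lin_op \<Rightarrow> ('a, 'b) lin_op"
  is "\<lambda>S T u. S u + T u" by (simp add: scal_add_right algebra_simps)
lift_definition minus_lin_op :: "('a, 'b) lin_op \<Rightarrow> ('a, 'b) lin_op \<Rightarrow> ('a, 'b) lin_op"
  is "\<lambda>S T u. S u - T u" by (simp add: scal_diff_right algebra_simps)
lift_definition uminus_lin_op :: "('a, 'b) lin_op \<Rightarrow> ('a, 'b) lin_op"
  is "\<lambda>S u. - S u" by (simp add: scal_minus_right)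
lift_definition times_lin_op :: "('a, 'b) lin_op \<Rightarrow> ('a, 'b) lin_op \<Rightarrow> ('a, 'b) lin_op"
  is "\<lambda>S T u. S (T u)" by simp

instance
proof
  show "(0 :: ('a, 'b) lin_op) \<noteq> 1"
  proof
    assume "(0 :: ('a, 'b) lin_op) = 1"
    then have "app (0 :: ('a, 'b) lin_op) u = app 1 u" for u by simp
    then have "(0 :: 'a \<Rightarrow>\<^sub>0 'b) = u" for u by (simp add: zero_lin_op.rep_eq one_lin_op.rep_eq)
    from this[of "Poly_Mapping.single undefined 1"] show False
      by (metis lookup_single_eq lookup_zero zero_neq_one)
  qed
qed (transfer; auto simp: algebra_simps fun_eq_iff)+

end

lemma app_simps:
  "app 0 u = 0" "app 1 u = u" "app (S + T) u = app S u + app T u"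
  "app (S - T) u = app S u - app T u" "app (- S) u = - app S u" "app (S * T) u = app S (app T u)"
  by (simp_all add: zero_lin_op.rep_eq one_lin_op.rep_eq plus_lin_op.rep_eq minus_lin_op.rep_eq
      uminus_lin_op.rep_eq times_lin_op.rep_eq)

lift_definition sc :: "'f::field \<Rightarrow> ('x, 'f) lin_op" is scal
  by (simp add: scal_add_right scal_scal mult.commute)

lemma app_sc: "app (sc c) u = scal c u"
  by (simp add: sc.rep_eq)

lemma sc_add: "sc (c + c') = sc c + sc c'"
  and sc_mult: "sc (c * c') = sc c * sc c'"
  and sc_minus: "sc (- c) = - sc c"
  and sc_zero: "sc 0 = 0"
  and sc_one: "sc 1 = 1"
  by (rule lin_op_eqI; simp add: app_sc app_simps scal_add_left scal_scal scal_minus_left scal_zero_left scal_one)+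

lemma sc_commute: "T * sc c = sc c * T"
  by (rule lin_op_eqI) (simp add: app_sc app_simps app_scal)

lemma sc_diff: "sc (c - c') = sc c - sc c'"
  by (metis add_uminus_conv_diff sc_add sc_minus)

lemma sc_of_nat: "sc (of_nat n) = of_nat n"
  by (induction n) (simp_all add: sc_zero sc_one sc_add)

lemma app_zero: "app T 0 = 0"
  using app_scal[of T 0 0] by (simp add: scal_zero_left)

lemma app_minus: "app T (- u) = - app T u"
  using app_scal[of T "-1" u] by (simp add: scal_minus_left scal_one)

lemma app_diff: "app T (u - v) = app T u - app T v"
  by (metis add_uminus_conv_diff app_add app_minus)

lemma app_sum: "app T (sum f S) = (\<Sum>x\<in>S. app T (f x))"
  by (induction S rule: infinite_finite_induct) (simp_all add: app_zero app_add)

lemma sum_app: "app (sum F S) u = (\<Sum>x\<in>S. app (F x) u)"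
  by (induction S rule: infinite_finite_induct) (simp_all add: app_simps)

lemma app_power: "app (T ^ n) u = (app T ^^ n) u"
  by (induction n) (simp_all add: app_simps)

lemma app_of_nat: "app (of_nat n) u = scal (of_nat n) u"
  by (simp add: sc_of_nat[symmetric] app_simps app_sc)

lemma lin_op_coeff_eqI:
  "(\<And>u z. Poly_Mapping.lookup (app S u) z = Poly_Mapping.lookup (app T u) z) \<Longrightarrow> S = T"
  by (intro lin_op_eqI poly_mapping_eqI)

section \<open>Commutators of linear operators\<close>

definition comm :: "'r::ring_1 \<Rightarrow> 'r \<Rightarrow> 'r" where
  "comm x y = x * y - y * x"

lemma comm_add_left: "comm (x + y) z = comm x z + comm y z"
  and comm_add_right: "comm x (y + z) = comm x y + comm x z"
  and comm_diff_left: "comm (x - y) z = comm x z - comm y z"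
  and comm_minus_left: "comm (- x) z = - comm x z"
  and comm_diff_right: "comm x (y - z) = comm x y - comm x z"
  and comm_mult: "comm x (y * z) = comm x y * z + y * comm x z"
  and comm_swap: "comm x y = - comm y x"
  and comm_jacobi: "comm (comm x y) z + comm (comm y z) x + comm (comm z x) y = 0"
  by (simp_all add: comm_def algebra_simps)

lemma comm_self: "comm x x = 0"
  by (simp add: comm_def)

lemma comm_zero: "comm x 0 = 0" "comm 0 x = 0"
  by (simp_all add: comm_def)

lemma comm_one: "comm x 1 = 0"
  by (simp add: comm_def)

lemma sc_left_commute: "T * (sc c * S) = sc c * (T * S)"
  by (metis mult.assoc sc_commute)

lemma sc_mult_mult: "(sc c * S) * (sc c' * T) = sc (c * c') * (S * T)"
  by (simp only: mult.assoc sc_left_commute[of S] sc_mult)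

lemma comm_sc: "comm (sc c * S) T = sc c * comm S T" "comm S (sc c * T) = sc c * comm S T"
  by (simp_all add: comm_def algebra_simps sc_left_commute)

text \<open>The power rule for the derivation \<open>[x, -]\<close>, valid when \<open>[x, y]\<close> commutes with \<open>y\<close>.\<close>

lemma comm_power:
  assumes "comm (comm x y) y = 0"
  shows "comm x (y ^ n) = of_nat n * y ^ (n - 1) * comm x y"
proof (induction n)
  case 0
  show ?case by (simp add: comm_def)
next
  case (Suc n)
  have c: "comm x y * y = y * comm x y" using assms by (simp add: comm_def[of "comm x y"])
  have "comm x y * y ^ n = y ^ n * comm x y"
    by (rule power_commuting_commutes[symmetric]) (rule c[symmetric])
  moreover have "y * (of_nat n * y ^ (n - 1) * comm x y) = of_nat n * y ^ n * comm x y"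
  proof (cases n)
    case (Suc n')
    have "y * (of_nat n * y ^ n' * comm x y) = (y * of_nat n) * y ^ n' * comm x y"
      by (simp only: mult.assoc)
    also have "y * of_nat n = of_nat n * y" by (simp only: mult_of_nat_commute)
    finally show ?thesis by (simp only: Suc diff_Suc_1 power_Suc mult.assoc)
  qed simp
  ultimately show ?case
    by (simp add: comm_mult Suc.IH algebra_simps)
qed

lemma comm_power_0: "comm x y = 0 \<Longrightarrow> comm x (y ^ n) = 0"
  by (simp add: comm_power comm_zero)

lemma app_comm: "app (comm S T) u = app S (app T u) - app T (app S u)"
  by (simp add: comm_def app_simps)

lemma lin_op_double_zero: "T = 0" if "T + T = 0" for T :: "('x, 'f::field_char_0) lin_op"
proof -
  have "T = sc (1/2) * (T + T)"
    by (simp add: distrib_left distrib_right[symmetric] sc_add[symmetric] sc_one)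
  then show ?thesis using that by simp
qed

text \<open>The combination of the Jacobi identities below that isolates one double commutator. Over the cyclic
permutations of \<open>s, t, u\<close>, the variables \<open>x\<close>, \<open>y\<close>, \<open>c\<close>, \<open>l\<close> stand for a matrix coefficient of
\<open>[C(s, t), L(u)]\<close>, \<open>[C(s, t), R(u)]\<close>, \<open>C([s, t], u)\<close>, \<open>L([[s, t], u])\<close>.\<close>

lemma jacobi_lincomb_left:
  fixes x1 x2 x3 y1 y2 y3 c1 c2 c3 l1 l2 l3 :: "'a::comm_ring_1"
  assumes "l1 - (c1 + c1) - (x1 + x1) + (l2 - (c2 + c2) - (x2 + x2)) + (l3 - (c3 + c3) - (x3 + x3)) = 0"
    "c2 - (y2 + y2) + x3 + x1 = 0" "c3 - (y3 + y3) + x1 + x2 = 0" "- c1 - (x1 + x1) + y2 + y3 = 0"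
  shows "6 * x1 - (l1 + l2 + l3 - 6 * c1) = 0"
proof -
  have "6 * x1 - (l1 + l2 + l3 - 6 * c1) = - 4 * (- c1 - (x1 + x1) + y2 + y3)
      - (l1 - (c1 + c1) - (x1 + x1) + (l2 - (c2 + c2) - (x2 + x2)) + (l3 - (c3 + c3) - (x3 + x3)))
      - 2 * (c2 - (y2 + y2) + x3 + x1) - 2 * (c3 - (y3 + y3) + x1 + x2)"
    by (simp add: algebra_simps)
  then show ?thesis by (simp only: assms) simp
qed

text \<open>The same for \<open>[C(s, t), R(u)]\<close>, with \<open>l\<close> standing for \<open>R([[s, t], u])\<close>.\<close>

lemma jacobi_lincomb_right:
  fixes x1 x2 x3 y1 y2 y3 c1 c2 c3 l1 l2 l3 :: "'a::comm_ring_1"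
  assumes "- (- l1 - (c1 + c1)) - (y1 + y1) + (- (- l2 - (c2 + c2)) - (y2 + y2)) + (- (- l3 - (c3 + c3)) - (y3 + y3)) = 0"
    "c1 - (y1 + y1) + x2 + x3 = 0" "- c2 - (x2 + x2) + y3 + y1 = 0" "- c3 - (x3 + x3) + y1 + y2 = 0"
  shows "6 * y1 - (l1 + l2 + l3 + 6 * c1) = 0"
proof -
  have "6 * y1 - (l1 + l2 + l3 + 6 * c1) = - 4 * (c1 - (y1 + y1) + x2 + x3)
      - (- (- l1 - (c1 + c1)) - (y1 + y1) + (- (- l2 - (c2 + c2)) - (y2 + y2)) + (- (- l3 - (c3 + c3)) - (y3 + y3)))
      - 2 * (- c2 - (x2 + x2) + y3 + y1) - 2 * (- c3 - (x3 + x3) + y1 + y2)"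
    by (simp add: algebra_simps)
  then show ?thesis by (simp only: assms) simp
qed

text \<open>The three hypotheses on commutators express every commutator of two multiplication operators through
\<open>L\<close>, \<open>R\<close> and \<open>C(s, t) = [L(s), R(t)]\<close>. Writing down the Jacobi identity for the triples \<open>LLL\<close>, \<open>RRR\<close>,
\<open>LLR\<close> and \<open>RRL\<close> then gives enough linear equations to determine the double commutators
\<open>[C(s, t), L(u)]\<close> and \<open>[C(s, t), R(u)]\<close> individually.\<close>

lemma jacobi_consequence:
  fixes L R :: "'m::ab_group_add \<Rightarrow> ('x, 'f::field_char_0) lin_op" and br :: "'m \<Rightarrow> 'm \<Rightarrow> 'm"
  assumes L_add: "\<And>s t. L (s + t) = L s + L t" and R_add: "\<And>s t. R (s + t) = R s + R t"
    and RL: "\<And>s t. comm (R s) (L t) = comm (L s) (R t)"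
    and LL: "\<And>s t. comm (L s) (L t) = L (br s t) - (comm (L s) (R t) + comm (L s) (R t))"
    and RR: "\<And>s t. comm (R s) (R t) = - R (br s t) - (comm (L s) (R t) + comm (L s) (R t))"
  shows "comm (comm (L s) (R t)) (L u) = sc (1/6) * L (jacobian br s t u) - comm (L (br s t)) (R u)"
    and "comm (comm (L s) (R t)) (R u) = sc (1/6) * R (jacobian br s t u) + comm (L (br s t)) (R u)"
proof -
  define C where "C s t = comm (L s) (R t)" for s t
  have RL': "comm (R s) (L t) = C s t" and LL': "comm (L s) (L t) = L (br s t) - (C s t + C s t)"
    and RR': "comm (R s) (R t) = - R (br s t) - (C s t + C s t)" 
    and LR': "comm (L s) (R t) = C s t" for s t
    using RL LL RR by (simp_all add: C_def)
  note cs = comm_add_left comm_diff_left comm_minus_left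
  note rels = RL' LL' RR' LR'
  define J where "J = jacobian br s t u"
  have LJ: "L J = L (br (br s t) u) + L (br (br t u) s) + L (br (br u s) t)"
    and RJ: "R J = R (br (br s t) u) + R (br (br t u) s) + R (br (br u s) t)"
    by (simp_all add: J_def jacobian_def L_add R_add)
  note E = comm_jacobi[of "L s" "L t" "L u"] comm_jacobi[of "R s" "R t" "R u"]
    comm_jacobi[of "L s" "L t" "R u"] comm_jacobi[of "L t" "L u" "R s"] comm_jacobi[of "L u" "L s" "R t"]
    comm_jacobi[of "R s" "R t" "L u"] comm_jacobi[of "R t" "R u" "L s"] comm_jacobi[of "R u" "R s" "L t"]
  note E' = E[unfolded rels cs]
  show "comm (comm (L s) (R t)) (L u) = sc (1/6) * L (jacobian br s t u) - comm (L (br s t)) (R u)"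
  proof (rule lin_op_coeff_eqI)
    fix v :: "'x \<Rightarrow>\<^sub>0 'f" and z
    define q where "q T = Poly_Mapping.lookup (app T v) z" for T
    have q: "q (S + T) = q S + q T" "q (S - T) = q S - q T" "q (- T) = - q T" "q 0 = 0"
       "q (sc c * T) = c * q T" for S T c
      by (simp_all add: q_def app_simps lookup_add lookup_minus app_sc)
    note F = E'[THEN arg_cong, where f = q, unfolded q rels, unfolded cs q rels]
    have "6 * q (comm (C s t) (L u)) = q (L J) - 6 * q (C (br s t) u)"
    proof -
      have "6 * q (comm (C s t) (L u)) - (q (L J) - 6 * q (C (br s t) u)) = 0"
        using F(1,4,5,6) unfolding LJ q by (rule jacobi_lincomb_left)
      then show ?thesis by simp
    qed
    then have "q (comm (C s t) (L u)) = 1/6 * q (L J) - q (C (br s t) u)" by (simp add: field_simps)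
    then show "q (comm (comm (L s) (R t)) (L u)) = q (sc (1/6) * L (jacobian br s t u) - comm (L (br s t)) (R u))"
      by (simp add: q LR' J_def)
  qed
  show "comm (comm (L s) (R t)) (R u) = sc (1/6) * R (jacobian br s t u) + comm (L (br s t)) (R u)"
  proof (rule lin_op_coeff_eqI)
    fix v :: "'x \<Rightarrow>\<^sub>0 'f" and z
    define q where "q T = Poly_Mapping.lookup (app T v) z" for T
    have q: "q (S + T) = q S + q T" "q (S - T) = q S - q T" "q (- T) = - q T" "q 0 = 0"
       "q (sc c * T) = c * q T" for S T c
      by (simp_all add: q_def app_simps lookup_add lookup_minus app_sc)
    note F = E'[THEN arg_cong, where f = q, unfolded q rels, unfolded cs q rels]
    have "6 * q (comm (C s t) (R u)) = q (R J) + 6 * q (C (br s t) u)"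
    proof -
      have "6 * q (comm (C s t) (R u)) - (q (R J) + 6 * q (C (br s t) u)) = 0"
        using F(2,3,7,8) unfolding RJ q by (rule jacobi_lincomb_right)
      then show ?thesis by simp
    qed
    then have "q (comm (C s t) (R u)) = 1/6 * q (R J) + q (C (br s t) u)" by (simp add: field_simps)
    then show "q (comm (comm (L s) (R t)) (R u)) = q (sc (1/6) * R (jacobian br s t u) + comm (L (br s t)) (R u))"
      by (simp add: q LR' J_def)
  qed
qed

section \<open>Iterated linear maps and their combinatorial coefficients\<close>

lemma falling_factorial_Suc:
  "falling_factorial n (Suc t) = (falling_factorial n t * of_nat (n - t) :: 'f::field_char_0)"
proof (cases "t \<le> n")
  case True
  then show ?thesis by (simp add: falling_factorial_def of_nat_diff)
next
  case False
  then show ?thesis by (simp add: falling_factorial_zero)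
qed

lemma falling_factorial_0: "falling_factorial n 0 = 1"
  by (simp add: falling_factorial_def)

lemma falling_factorial_add:
  "falling_factorial n (s + t) = (falling_factorial n s * falling_factorial (n - s) t :: 'f::field_char_0)"
  by (induction t) (simp_all add: falling_factorial_Suc falling_factorial_0)

lemma binomial_choose_Suc: "(J choose \<epsilon>) * (J - \<epsilon>) = Suc \<epsilon> * (J choose Suc \<epsilon>)"
proof (cases J)
  case (Suc J')
  then show ?thesis
    using binomial_absorb_comp[of J \<epsilon>] Suc_times_binomial[of \<epsilon> J'] by (simp add: mult.commute)
qed simp

lemma falling_factorial_binomial:
  assumes "t \<le> n"
  shows "(falling_factorial n t :: 'f::field_char_0) = fact t * of_nat (n choose t)"
  using assms
proof (induction t)
  case (Suc t)
  have "falling_factorial n (Suc t) = (fact t :: 'f) * of_nat ((n choose t) * (n - t))"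
    using Suc by (simp add: falling_factorial_Suc)
  then show ?case unfolding binomial_choose_Suc by (simp add: algebra_simps)
qed (simp add: falling_factorial_0)

lemma multinomial_Nil: "multinomial n [] = 1"
  by (simp add: multinomial_def)

lemma multinomial_Cons:
  assumes "k \<le> n"
  shows "multinomial n (k # ks) = of_nat (n choose k) * (multinomial (n - k) ks :: 'f::field_char_0)"
  using assms by (simp add: multinomial_def binomial_fact)

lemma minus_one_power_cong: "even (a + b) \<Longrightarrow> (- 1 :: 'a::ring_1) ^ a = (- 1) ^ b"
  by (auto simp: minus_one_power_iff)

text \<open>Both sides sum over \<open>\<zeta> + \<delta> + \<epsilon> \<le> N\<close>, with \<open>s = \<delta> + \<epsilon>\<close> on the left.\<close>

lemma sum_triangle:
  fixes f :: "nat \<Rightarrow> nat \<Rightarrow> nat \<Rightarrow> 'a::comm_monoid_add"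
  shows "(\<Sum>\<zeta>\<le>N. \<Sum>s\<le>N - \<zeta>. \<Sum>\<delta>\<le>s. f \<zeta> s \<delta>) = (\<Sum>\<delta>\<le>N. \<Sum>\<epsilon>\<le>N - \<delta>. \<Sum>\<zeta>\<le>N - \<delta> - \<epsilon>. f \<zeta> (\<delta> + \<epsilon>) \<delta>)"
proof -
  have "(\<Sum>\<zeta>\<le>N. \<Sum>s\<le>N - \<zeta>. \<Sum>\<delta>\<le>s. f \<zeta> s \<delta>)
      = (\<Sum>(\<zeta>, s, \<delta>)\<in>(SIGMA \<zeta>:{..N}. SIGMA s:{..N - \<zeta>}. {..s}). f \<zeta> s \<delta>)"
    by (simp add: sum.Sigma)
  also have "\<dots> = (\<Sum>(\<delta>, \<epsilon>, \<zeta>)\<in>(SIGMA \<delta>:{..N}. SIGMA \<epsilon>:{..N - \<delta>}. {..N - \<delta> - \<epsilon>}). f \<zeta> (\<delta> + \<epsilon>) \<delta>)"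
    by (rule sum.reindex_bij_witness[of _ "\<lambda>(\<delta>, \<epsilon>, \<zeta>). (\<zeta>, \<delta> + \<epsilon>, \<delta>)" "\<lambda>(\<zeta>, s, \<delta>). (\<delta>, s - \<delta>, \<zeta>)"]) auto
  also have "\<dots> = (\<Sum>\<delta>\<le>N. \<Sum>\<epsilon>\<le>N - \<delta>. \<Sum>\<zeta>\<le>N - \<delta> - \<epsilon>. f \<zeta> (\<delta> + \<epsilon>) \<delta>)"
    by (simp add: sum.Sigma)
  finally show ?thesis .
qed

lemma sum_swap_dependent:
  fixes f :: "nat \<Rightarrow> nat \<Rightarrow> nat \<Rightarrow> nat \<Rightarrow> 'a::comm_monoid_add"
  shows "(\<Sum>a\<le>n. \<Sum>b\<le>n - a. \<Sum>c\<le>m. \<Sum>d\<le>m - c. f a b c d) = (\<Sum>c\<le>m. \<Sum>d\<le>m - c. \<Sum>a\<le>n. \<Sum>b\<le>n - a. f a b c d)"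
proof -
  have "(\<Sum>a\<le>n. \<Sum>b\<le>n - a. g a b) = (\<Sum>x\<in>(SIGMA a:{..n}. {..n - a}). g (fst x) (snd x))"
    for n and g :: "nat \<Rightarrow> nat \<Rightarrow> 'a"
    by (simp add: sum.Sigma case_prod_beta)
  then show ?thesis
    by (simp only:) (rule sum.swap)
qed

context Modules.module
begin

text \<open>If applying \<open>T\<close> moves the index pair by one step to the right or by one step up, then \<open>T\<^sup>n\<close> is the sum over the
lattice paths of length \<open>n\<close>. Stating this for indexed families instead of powers of commuting operators lets it
serve for derivations and for families of vectors alike.\<close>

lemma binomial_iterate:
  assumes add: "\<And>x y. T (x + y) = T x + T y" and hom: "\<And>c x. T (scale c x) = scale c (T x)"
    and step: "\<And>x y. T (w x y) = w (Suc x) y + w x (Suc y)"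
  shows "(T ^^ n) (w 0 0) = (\<Sum>x\<le>n. scale (of_nat (n choose x)) (w x (n - x)))"
proof (induction n)
  case 0
  show ?case by simp
next
  case (Suc n)
  have zero: "T 0 = 0" using hom[of 0 0] by simp
  have T_sum: "T (sum f A) = (\<Sum>x\<in>A. T (f x))" for f :: "nat \<Rightarrow> 'b" and A
    by (induction A rule: infinite_finite_induct) (simp_all add: zero add)
  have "(T ^^ Suc n) (w 0 0) = (\<Sum>x\<le>n. scale (of_nat (n choose x)) (w (Suc x) (n - x)))
      + (\<Sum>x\<le>n. scale (of_nat (n choose x)) (w x (Suc n - x)))"
    by (simp add: Suc.IH T_sum hom step scale_right_distrib sum.distrib Suc_diff_le)
  also have "(\<Sum>x\<le>n. scale (of_nat (n choose x)) (w x (Suc n - x)))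
      = (\<Sum>x\<le>Suc n. scale (of_nat (n choose x)) (w x (Suc n - x)))" by (simp add: binomial_eq_0)
  also have "\<dots> = w 0 (Suc n) + (\<Sum>x\<le>n. scale (of_nat (n choose Suc x)) (w (Suc x) (n - x)))"
    by (subst sum.atMost_Suc_shift) simp
  also have "(\<Sum>x\<le>n. scale (of_nat (n choose x)) (w (Suc x) (n - x))) + \<dots>
      = w 0 (Suc n) + (\<Sum>x\<le>n. scale (of_nat (Suc n choose Suc x)) (w (Suc x) (n - x)))"
    by (simp add: scale_left_distrib sum.distrib algebra_simps)
  also have "\<dots> = (\<Sum>x\<le>Suc n. scale (of_nat (Suc n choose x)) (w x (Suc n - x)))"
    by (simp add: sum.atMost_Suc_shift del: sum.atMost_Suc)
  finally show ?case .
qed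

text \<open>Three directions reduce to two by collecting the last two: their binomial sum \<open>w x m\<close> moves by Pascal's
rule.\<close>

lemma trinomial_iterate:
  assumes add: "\<And>x y. T (x + y) = T x + T y" and hom: "\<And>c x. T (scale c x) = scale c (T x)"
    and step: "\<And>x y z. T (v x y z) = v (Suc x) y z + v x (Suc y) z + v x y (Suc z)"
  shows "(T ^^ n) (v 0 0 0) =
    (\<Sum>x\<le>n. \<Sum>y\<le>n - x. scale (of_nat ((n choose x) * (n - x choose y))) (v x y (n - x - y)))"
proof -
  define w where "w x m = (\<Sum>y\<le>m. scale (of_nat (m choose y)) (v x y (m - y)))" for x m
  have zero: "T 0 = 0" using hom[of 0 0] by simp
  have T_sum: "T (sum f A) = (\<Sum>x\<in>A. T (f x))" for f :: "nat \<Rightarrow> 'b" and A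
    by (induction A rule: infinite_finite_induct) (simp_all add: zero add)
  have w_Suc: "w x (Suc m) = (\<Sum>y\<le>m. scale (of_nat (m choose y)) (v x (Suc y) (m - y) + v x y (Suc (m - y))))"
    for x m
  proof -
    have "(\<Sum>y\<le>m. scale (of_nat (m choose y)) (v x y (Suc (m - y))))
        = (\<Sum>y\<le>Suc m. scale (of_nat (m choose y)) (v x y (Suc m - y)))"
      by (simp add: Suc_diff_le binomial_eq_0)
    also have "\<dots> = v x 0 (Suc m) + (\<Sum>y\<le>m. scale (of_nat (m choose Suc y)) (v x (Suc y) (m - y)))"
      by (subst sum.atMost_Suc_shift) simp
    finally show ?thesis
      unfolding w_def
      by (subst sum.atMost_Suc_shift) (simp add: scale_right_distrib scale_left_distrib sum.distrib algebra_simps)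
  qed
  have "T (w x m) = w (Suc x) m + w x (Suc m)" for x m
    unfolding w_Suc by (simp add: w_def T_sum hom step scale_right_distrib sum.distrib algebra_simps)
  from binomial_iterate[of T w n, OF add hom this] have
    "(T ^^ n) (w 0 0) = (\<Sum>x\<le>n. scale (of_nat (n choose x)) (w x (n - x)))" .
  then show ?thesis
    by (simp add: w_def scale_sum_right)
qed

text \<open>The step condition says that formally \<open>exp(t T) (G 0)\<close> is the sum of all \<open>(1 - exp(-t))\<^sup>s G s\<close>, and the
coefficient of \<open>t\<^sup>n / n!\<close> in \<open>(1 - exp(-t))\<^sup>s\<close> is a signed multiple of a Stirling number of the second kind.\<close>

lemma Stirling_iterate:
  assumes add: "\<And>x y. T (x + y) = T x + T y" and hom: "\<And>c x. T (scale c x) = scale c (T x)"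
    and step: "\<And>s. T (G s) = scale (of_nat (Suc s)) (G (Suc s)) - scale (of_nat s) (G s)"
  shows "(T ^^ n) (G 0) = (\<Sum>s\<le>n. scale ((- 1) ^ (n - s) * of_nat (fact s * Stirling n s)) (G s))"
proof (induction n)
  case 0
  show ?case by simp
next
  case (Suc n)
  have zero: "T 0 = 0" using hom[of 0 0] by simp
  have T_sum: "T (sum f A) = (\<Sum>x\<in>A. T (f x))" for f :: "nat \<Rightarrow> 'b" and A
    by (induction A rule: infinite_finite_induct) (simp_all add: zero add)
  let ?c = "\<lambda>n s. (- 1) ^ (n - s) * of_nat (fact s * Stirling n s) :: 'a"
  have "(T ^^ Suc n) (G 0) = (\<Sum>s\<le>n. scale (?c n s * of_nat (Suc s)) (G (Suc s)))
      + (\<Sum>s\<le>n. scale (- (?c n s * of_nat s)) (G s))"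
    by (simp add: Suc.IH T_sum hom step scale_right_diff_distrib sum_subtractf sum_negf)
  also have "(\<Sum>s\<le>n. scale (- (?c n s * of_nat s)) (G s)) = (\<Sum>s\<le>Suc n. scale (- (?c n s * of_nat s)) (G s))"
    by simp
  also have "\<dots> = (\<Sum>s\<le>n. scale (- (?c n (Suc s) * of_nat (Suc s))) (G (Suc s)))"
    by (subst sum.atMost_Suc_shift) simp
  also have "(\<Sum>s\<le>n. scale (?c n s * of_nat (Suc s)) (G (Suc s))) + \<dots>
      = (\<Sum>s\<le>n. scale (?c (Suc n) (Suc s)) (G (Suc s)))"
    unfolding sum.distrib[symmetric] scale_left_distrib[symmetric]
  proof (rule sum.cong[OF refl])
    fix s assume s: "s \<in> {..n}"
    have "?c n s * of_nat (Suc s) + - (?c n (Suc s) * of_nat (Suc s)) = ?c (Suc n) (Suc s)"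
    proof (cases "s = n")
      case False
      with s have "n - s = Suc (n - Suc s)" by auto
      then show ?thesis by (simp add: algebra_simps)
    qed (simp add: algebra_simps)
    then show "scale (?c n s * of_nat (Suc s) + - (?c n (Suc s) * of_nat (Suc s))) (G (Suc s))
        = scale (?c (Suc n) (Suc s)) (G (Suc s))" by simp
  qed
  also have "\<dots> = (\<Sum>s\<le>Suc n. scale (?c (Suc n) s) (G s))"
    by (simp add: sum.atMost_Suc_shift del: sum.atMost_Suc)
  finally show ?case .
qed

end

interpretation vec: vector_space scal
  by unfold_locales (simp_all add: scal_add_right scal_add_left scal_scal scal_one)

interpretation op: Modules.module "\<lambda>c (T :: ('x, 'f::field) lin_op). sc c * T"
  by unfold_locales (simp_all add: sc_add sc_mult sc_one algebra_simps)

section \<open>Algebras generated by a Malcev algebra\<close>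

text \<open>The universal nonassociative enveloping algebra of \<open>M\<close> as an algebra inside a possibly bigger vector space: multiplication
by \<open>one\<close> is a projection onto the algebra, the
identity on products but not necessarily on the whole space. The ambient space can then be a
type even when the algebra is a quotient that depends on parameters.\<close>

locale env_alg =
  fixes mul :: "('x \<Rightarrow>\<^sub>0 'f) \<Rightarrow> ('x \<Rightarrow>\<^sub>0 'f) \<Rightarrow> ('x \<Rightarrow>\<^sub>0 'f::field_char_0)"
    and one :: "'x \<Rightarrow>\<^sub>0 'f"
    and h :: "('m \<Rightarrow>\<^sub>0 'f) \<Rightarrow> ('x \<Rightarrow>\<^sub>0 'f)"
    and br :: "('m \<Rightarrow>\<^sub>0 'f) \<Rightarrow> ('m \<Rightarrow>\<^sub>0 'f) \<Rightarrow> ('m \<Rightarrow>\<^sub>0 'f)"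
  assumes mul_add_left: "mul (x + y) z = mul x z + mul y z"
    and mul_add_right: "mul x (y + z) = mul x y + mul x z"
    and mul_scal_left: "mul (scal c x) y = scal c (mul x y)"
    and mul_scal_right: "mul x (scal c y) = scal c (mul x y)"
    and h_add: "h (s + t) = h s + h t"
    and h_scal: "h (scal c s) = scal c (h s)"
    and bracket: "mul (h s) (h t) - mul (h t) (h s) = h (br s t)"
    and alternative_left: "mul (mul (h s) x) y - mul (h s) (mul x y) = - (mul (mul x (h s)) y - mul x (mul (h s) y))"
    and alternative_right: "mul (mul x (h s)) y - mul x (mul (h s) y) = - (mul (mul x y) (h s) - mul x (mul y (h s)))"
    and one_mul_one: "mul one one = one"
    and one_mul: "mul one (mul x y) = mul x y"
    and mul_one: "mul x one = mul one x"
    and one_mul_left: "mul (mul one x) y = mul x y"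
    and one_mul_right: "mul x (mul one y) = mul x y"
    and one_h: "mul one (h s) = h s"
    and generated: "vec.subspace S \<Longrightarrow> one \<in> S \<Longrightarrow> (\<And>s. h s \<in> S) \<Longrightarrow>
      (\<And>x y. x \<in> S \<Longrightarrow> y \<in> S \<Longrightarrow> mul x y \<in> S) \<Longrightarrow> mul one x \<in> S"
begin

definition Lop :: "('x \<Rightarrow>\<^sub>0 'f) \<Rightarrow> ('x, 'f) lin_op" where "Lop x = Lin_op (mul x)"
definition Rop :: "('x \<Rightarrow>\<^sub>0 'f) \<Rightarrow> ('x, 'f) lin_op" where "Rop x = Lin_op (\<lambda>y. mul y x)"

lemma app_Lop: "app (Lop x) y = mul x y" and app_Rop: "app (Rop x) y = mul y x"
  by (simp_all add: Lop_def Rop_def Lin_op_inverse mul_add_left mul_add_right mul_scal_left mul_scal_right)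

lemma mul_diff_left: "mul (x - y) z = mul x z - mul y z"
  by (metis add_diff_cancel diff_add_cancel mul_add_left)

lemma mul_diff_right: "mul z (x - y) = mul z x - mul z y"
  by (metis add_diff_cancel diff_add_cancel mul_add_right)

abbreviation L :: "('m \<Rightarrow>\<^sub>0 'f) \<Rightarrow> ('x, 'f) lin_op" where "L s \<equiv> Lop (h s)"
abbreviation R :: "('m \<Rightarrow>\<^sub>0 'f) \<Rightarrow> ('x, 'f) lin_op" where "R s \<equiv> Rop (h s)"

lemma L_add: "L (s + t) = L s + L t" and R_add: "R (s + t) = R s + R t"
  by (rule lin_op_eqI; simp add: app_Lop app_Rop app_simps h_add mul_add_left mul_add_right)+

lemma L_scal: "L (scal c s) = sc c * L s" and R_scal: "R (scal c s) = sc c * R s"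
  by (rule lin_op_eqI; simp add: app_Lop app_Rop app_simps app_sc h_scal mul_scal_left mul_scal_right)+

text \<open>The alternative laws give \<open>(s, x, y) = (x, y, s)\<close>; as an identity of operators in \<open>y\<close> this is a recursion
for left multiplication by products with a left factor in \<open>M\<close>.\<close>

lemma Lop_mul_h: "Lop (mul (h s) x) = L s * Lop x + comm (R s) (Lop x)"
proof (rule lin_op_eqI)
  fix y
  show "app (Lop (mul (h s) x)) y = app (L s * Lop x + comm (R s) (Lop x)) y"
    using alternative_left[of s x y] alternative_right[of x s y]
    by (simp add: app_Lop app_Rop app_simps app_comm algebra_simps)
qed

text \<open>Up to sign, both commutators are associators with two arguments in \<open>M\<close>, and those are alternating.\<close>

lemma comm_RL: "comm (R s) (L t) = comm (L s) (R t)"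
proof (rule lin_op_eqI)
  fix y
  show "app (comm (R s) (L t)) y = app (comm (L s) (R t)) y"
  proof -
    have "mul (mul (h t) y) (h s) - mul (h t) (mul y (h s))
        = - (mul (mul y (h t)) (h s) - mul y (mul (h t) (h s)))" by (rule alternative_left)
    also have "\<dots> = mul (mul y (h s)) (h t) - mul y (mul (h s) (h t))"
      by (simp add: alternative_right[of y t "h s"])
    also have "\<dots> = - (mul (mul (h s) y) (h t) - mul (h s) (mul y (h t)))"
      by (simp add: alternative_left[of s y "h t"])
    finally show ?thesis
      by (simp add: app_Lop app_Rop app_simps app_comm)
  qed
qed

text \<open>Antisymmetrise the recursion for \<open>L(s t)\<close> in \<open>s\<close> and \<open>t\<close>.\<close>

lemma comm_LL: "comm (L s) (L t) = L (br s t) - (comm (L s) (R t) + comm (L s) (R t))"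
proof -
  have "L (br s t) = Lop (mul (h s) (h t)) - Lop (mul (h t) (h s))"
    by (rule lin_op_eqI) (simp add: app_Lop app_simps bracket[symmetric] mul_diff_left)
  also have "\<dots> = comm (L s) (L t) + comm (R s) (L t) - comm (R t) (L s)"
    by (simp add: Lop_mul_h comm_def algebra_simps)
  also have "comm (R t) (L s) = - comm (L s) (R t)" by (rule comm_swap)
  finally show ?thesis by (simp add: comm_RL algebra_simps)
qed

lemma comm_RR: "comm (R s) (R t) = - R (br s t) - (comm (L s) (R t) + comm (L s) (R t))"
proof -
  have *: "Rop (mul (h t) (h s)) = R s * R t + comm (R s) (L t)" for s t
  proof (rule lin_op_eqI)
    fix y
    show "app (Rop (mul (h t) (h s))) y = app (R s * R t + comm (R s) (L t)) y"
      using alternative_left[of t y "h s"]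
      by (simp add: app_Lop app_Rop app_simps app_comm algebra_simps)
  qed
  have "R (br s t) = Rop (mul (h s) (h t)) - Rop (mul (h t) (h s))"
    by (rule lin_op_eqI) (simp add: app_Rop app_simps bracket[symmetric] mul_diff_right)
  also have "\<dots> = - comm (R s) (R t) + comm (R t) (L s) - comm (R s) (L t)"
    by (simp add: * comm_def algebra_simps)
  also have "comm (R t) (L s) = - comm (L s) (R t)" by (rule comm_swap)
  finally have *: "R (br s t) = - comm (R s) (R t) - comm (L s) (R t) - comm (L s) (R t)"
    by (simp add: comm_RL)
  show ?thesis unfolding * by simp
qed

lemmas comm_LR_left = jacobi_consequence(1)[of L R br, OF L_add R_add comm_RL comm_LL comm_RR]
lemmas comm_LR_right = jacobi_consequence(2)[of L R br, OF L_add R_add comm_RL comm_LL comm_RR]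

text \<open>The span \<open>W\<close> of the words \<open>L(s\<^sub>1) \<cdots> L(s\<^sub>n) 1\<close> is closed under multiplication: moving \<open>R(s)\<close> or \<open>C(s, t)\<close>
past a letter only produces operators of the form \<open>L\<close>, \<open>R\<close> or \<open>C\<close>, so \<open>W\<close> is stable under \<open>R(s)\<close>, and then the recursion
for \<open>L(s x)\<close> shows by induction that \<open>W\<close> is stable under left multiplication by its own elements. As the algebra
is generated by \<open>M\<close>, it equals \<open>W\<close>.\<close>

lemma spanned_by_words:
  assumes sub: "vec.subspace S" and one: "one \<in> S" and closed: "\<And>s x. x \<in> S \<Longrightarrow> mul (h s) x \<in> S"
  shows "mul one x \<in> S"
proof -
  define good where "good S \<longleftrightarrow> vec.subspace S \<and> one \<in> S \<and> (\<forall>s. \<forall>x\<in>S. mul (h s) x \<in> S)" for S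
  define W where "W = \<Inter>{S. good S}"
  have W_sub: "vec.subspace W" unfolding W_def
    by (rule vec.subspace_Inter) (auto simp: good_def)
  note W_add = vec.subspace_add[OF W_sub] and W_diff = vec.subspace_diff[OF W_sub]
    and W_scal = vec.subspace_scale[OF W_sub] and W_zero = vec.subspace_0[OF W_sub]
  have W_one: "one \<in> W" and W_L: "x \<in> W \<Longrightarrow> mul (h s) x \<in> W" for s x
    by (auto simp: W_def good_def)
  have W_induct: "W \<subseteq> T" if "good T" for T using that by (auto simp: W_def)
  have W_unit: "mul one x = x" if "x \<in> W" for x
  proof -
    have "good {x. mul one x = x}"
      by (auto simp: good_def one_mul_one one_mul vec.subspace_def mul_add_right mul_scal_right
          scal_zero_right intro: mul_scal_right[of one 0 0, unfolded scal_zero_left])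
    with that W_induct show ?thesis by blast
  qed
  have W_RC: "mul x (h s) \<in> W \<and> app (comm (L s) (R t)) x \<in> W" if "x \<in> W" for s t x
  proof -
    have "good {x \<in> W. \<forall>s t. mul x (h s) \<in> W \<and> app (comm (L s) (R t)) x \<in> W}" (is "good ?T")
      unfolding good_def
    proof (intro conjI allI ballI)
      show "vec.subspace ?T"
        using app_zero[of "Rop _", unfolded app_Rop]
        by (auto simp: vec.subspace_def W_zero W_add W_scal mul_add_left mul_scal_left app_add app_scal app_zero)
      have "mul (h s) one = h s" "mul one (h s) = h s" for s
        by (simp_all add: mul_one one_h)
      moreover from this have "h s \<in> W" for s using W_L[OF W_one, of s] by simp
      ultimately show "one \<in> ?T"
        by (auto simp: W_one W_zero app_comm app_Lop app_Rop intro!: W_diff W_L)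
    next
      fix u x assume x: "x \<in> ?T"
      have C: "app (comm (L s) (R t)) (mul (h u) x) \<in> W" for s t
      proof -
        have "app (comm (L s) (R t)) (mul (h u) x)
            = app (comm (comm (L s) (R t)) (L u)) x + mul (h u) (app (comm (L s) (R t)) x)"
          by (simp add: app_comm app_Lop)
        also have "\<dots> \<in> W" unfolding comm_LR_left
          using x by (auto simp: app_simps app_sc app_Lop intro!: W_add W_diff W_scal W_L)
        finally show ?thesis .
      qed
      have "mul (mul (h u) x) (h s) = mul (h u) (mul x (h s)) - app (comm (L u) (R s)) x" for s
        by (simp add: app_comm app_Lop app_Rop)
      then show "mul (h u) x \<in> ?T"
        using x C by (auto intro!: W_L W_diff)
    qed
    with that W_induct show ?thesis by blast
  qed
  have W_mul: "mul x y \<in> W" if "x \<in> W" "y \<in> W" for x y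
  proof -
    have "good {x. \<forall>y\<in>W. mul x y \<in> W}" (is "good ?T")
      unfolding good_def
    proof (intro conjI allI ballI)
      show "vec.subspace ?T"
        using app_zero[of "Rop _", unfolded app_Rop]
        by (auto simp: vec.subspace_def W_zero W_add W_scal mul_add_left mul_scal_left)
      show "one \<in> ?T" by (simp add: W_unit)
      fix s x assume x: "x \<in> ?T"
      have "mul (mul (h s) x) y = mul (h s) (mul x y) + mul (mul x y) (h s) - mul x (mul y (h s))" for y
        using arg_cong[OF Lop_mul_h, of "\<lambda>T. app T y" s x]
        by (simp add: app_Lop app_Rop app_simps app_comm)
      then show "mul (h s) x \<in> ?T"
        using x W_RC by (auto intro!: W_add W_diff W_L)
    qed
    with that W_induct show ?thesis by blast
  qed
  have "h s \<in> W" for s using W_L[OF W_one, of s] by (simp add: mul_one one_h)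
  from generated[OF W_sub W_one this W_mul] have "mul one x \<in> W" .
  moreover have "W \<subseteq> S" by (rule W_induct) (simp add: good_def assms)
  ultimately show ?thesis by blast
qed

text \<open>An operator that can be moved past each letter, possibly changing the operator on its left, kills all words once it
kills the unit.\<close>

lemma vanish_on_words:
  assumes "app T one = 0" and "\<And>s. \<exists>Y. T * L s = Y * T" and "\<And>x. app T (mul one x) = app T x"
  shows "T = 0"
proof (rule lin_op_eqI)
  fix x
  have "mul one x \<in> {x. app T x = 0}"
  proof (rule spanned_by_words)
    show "vec.subspace {x. app T x = 0}"
      by (auto simp: vec.subspace_def app_zero app_add app_scal scal_zero_right)
    show "one \<in> {x. app T x = 0}" using assms(1) by simp
    fix s x assume "x \<in> {x. app T x = 0}"
    then have x: "app T x = 0" by simp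
    obtain Y where Y: "T * L s = Y * T" using assms(2) by blast
    have "app T (mul (h s) x) = app (T * L s) x" by (simp add: app_simps app_Lop)
    also have "\<dots> = 0" unfolding Y by (simp add: app_simps x app_zero)
    finally show "mul (h s) x \<in> {x. app T x = 0}" by simp
  qed
  then show "app T x = app 0 x" using assms(3) by (simp add: app_simps)
qed

end

section \<open>The multiplication operators of the generators\<close>

lemma M_bracket_basis:
  "M_bracket \<gamma> (basis_vec ga) (basis_vec gb) = - basis_vec gb"
  "M_bracket \<gamma> (basis_vec ga) (basis_vec gc) = - basis_vec gc"
  "M_bracket \<gamma> (basis_vec ga) (basis_vec gd) = basis_vec gd"
  "M_bracket \<gamma> (basis_vec ga) (basis_vec ge) = scal \<gamma> (basis_vec ge)"
  "M_bracket \<gamma> (basis_vec gb) (basis_vec gc) = scal 2 (basis_vec gd)"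
  "M_bracket \<gamma> (basis_vec gb) (basis_vec gd) = 0"
  "M_bracket \<gamma> (basis_vec gb) (basis_vec ge) = 0"
  "M_bracket \<gamma> (basis_vec gc) (basis_vec gd) = 0"
  "M_bracket \<gamma> (basis_vec gc) (basis_vec ge) = 0"
  "M_bracket \<gamma> (basis_vec gd) (basis_vec ge) = 0"
  by (rule gen_vec_eqI; simp add: lookup_M_bracket lookup_single)+

lemma M_jacobian:
  "jacobian (M_bracket \<gamma>) x y z = scal (- 6 * (Poly_Mapping.lookup x ga * (Poly_Mapping.lookup y gb * Poly_Mapping.lookup z gc - Poly_Mapping.lookup y gc * Poly_Mapping.lookup z gb)
     + Poly_Mapping.lookup x gb * (Poly_Mapping.lookup y gc * Poly_Mapping.lookup z ga - Poly_Mapping.lookup y ga * Poly_Mapping.lookup z gc)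
     + Poly_Mapping.lookup x gc * (Poly_Mapping.lookup y ga * Poly_Mapping.lookup z gb - Poly_Mapping.lookup y gb * Poly_Mapping.lookup z ga))) (basis_vec gd)"
  unfolding jacobian_def
  by (rule gen_vec_eqI; simp add: lookup_M_bracket lookup_add lookup_single ring_distribs; simp add: algebra_simps)

lemma gen_vec_expand:
  fixes s :: "gen \<Rightarrow>\<^sub>0 'f::field"
  shows "s = scal (Poly_Mapping.lookup s ga) (basis_vec ga) + scal (Poly_Mapping.lookup s gb) (basis_vec gb) + scal (Poly_Mapping.lookup s gc) (basis_vec gc)
    + scal (Poly_Mapping.lookup s gd) (basis_vec gd) + scal (Poly_Mapping.lookup s ge) (basis_vec ge)"
  by (rule gen_vec_eqI) (simp_all add: lookup_add lookup_single)

locale env_M = env_alg mul one h "M_bracket \<gamma>"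
  for mul :: "('x \<Rightarrow>\<^sub>0 'f) \<Rightarrow> ('x \<Rightarrow>\<^sub>0 'f) \<Rightarrow> ('x \<Rightarrow>\<^sub>0 'f::field_char_0)"
    and one :: "'x \<Rightarrow>\<^sub>0 'f"
    and h :: "(gen \<Rightarrow>\<^sub>0 'f) \<Rightarrow> ('x \<Rightarrow>\<^sub>0 'f)"
    and \<gamma> :: 'f
begin

definition "A = L (basis_vec ga)"
definition "B = L (basis_vec gb)"
definition "C = L (basis_vec gc)"
definition "D = L (basis_vec gd)"
definition "E = L (basis_vec ge)"
definition "RA = R (basis_vec ga)"
definition "RB = R (basis_vec gb)"
definition "RC = R (basis_vec gc)"
definition "RD = R (basis_vec gd)"
definition "RE = R (basis_vec ge)"
definition "P = comm A RB"
definition "Q = comm A RC"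

lemmas L_defs = A_def B_def C_def D_def E_def and R_defs = RA_def RB_def RC_def RD_def RE_def

text \<open>\<open>C(s, t)\<close> is antisymmetric because \<open>[L(s), R(t)] = [R(s), L(t)]\<close>.\<close>

lemma LR_swap: "comm (L s) (R t) = - comm (L t) (R s)"
  using comm_RL[of s t] comm_swap[of "R s" "L t"] by simp

lemma LR_zero_swap: "comm (L s) (R t) = 0 \<Longrightarrow> comm (L t) (R s) = 0"
  using LR_swap[of t s] by simp

lemma LR_same: "comm (L s) (R s) = 0"
  using LR_swap[of s s] lin_op_double_zero[of "comm (L s) (R s)"] by (simp add: eq_neg_iff_add_eq_0)

lemma L_zero: "L 0 = 0" and R_zero: "R 0 = 0"
  using L_scal[of 0 0] R_scal[of 0 0] by (simp_all add: scal_zero_left sc_zero)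

lemma L_minus: "L (- s) = - L s" and R_minus: "R (- s) = - R s"
  using L_add[of s "- s"] R_add[of s "- s"] by (simp_all add: L_zero R_zero eq_neg_iff_add_eq_0 add.commute)

text \<open>For \<open>C(a, d)\<close> and \<open>C(a, e)\<close> the commutator with \<open>L(a)\<close> comes out as a multiple of the operator itself;
hence the scalar \<open>t\<close>.\<close>

lemma vanish_on_generators:
  assumes "app T one = 0" and "\<And>x. app T (mul one x) = app T x"
    and A: "comm T A = sc t * T" and B: "comm T B = 0" and C: "comm T C = 0" and D: "comm T D = 0" and E: "comm T E = 0"
  shows "T = 0"
proof (rule vanish_on_words)
  fix s :: "gen \<Rightarrow>\<^sub>0 'f"
  let ?l = "Poly_Mapping.lookup s"
  have s: "L s = sc (?l ga) * A + sc (?l gb) * B + sc (?l gc) * C + sc (?l gd) * D + sc (?l ge) * E"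
    by (subst gen_vec_expand[of s]) (simp add: L_add L_scal L_defs)
  have "comm T (L s) = sc (?l ga * t) * T"
    unfolding s by (simp only: comm_add_right comm_sc A B C D E sc_mult mult.assoc mult_zero_right add_0_right)
  then have "T * L s = (L s + sc (?l ga * t)) * T"
    by (simp only: comm_def diff_eq_eq distrib_right add.commute)
  then show "\<exists>Y. T * L s = Y * T" by blast
qed (use assms in auto)

lemma LR_one: "app (comm (L s) (R t)) one = 0"
  by (simp add: app_comm app_Lop app_Rop mul_one one_h)

lemma LR_absorb: "app (comm (L s) (R t)) (mul one x) = app (comm (L s) (R t)) x"
  by (simp add: app_comm app_Lop app_Rop one_mul_left one_mul_right)

lemma LR_vanish:
  assumes "comm (comm (L s) (R u)) A = sc t * comm (L s) (R u)" and "comm (comm (L s) (R u)) B = 0"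
    and "comm (comm (L s) (R u)) C = 0" and "comm (comm (L s) (R u)) D = 0" and "comm (comm (L s) (R u)) E = 0"
  shows "comm (L s) (R u) = 0"
  using vanish_on_generators[OF LR_one LR_absorb assms] .

lemmas gen_simps = M_jacobian M_bracket_basis lookup_single scal_zero_left L_zero R_zero comm_zero sc_zero
  L_minus R_minus comm_minus_left L_scal R_scal comm_sc

text \<open>For these pairs the bracket and the Jacobian with any third element vanish, so \<open>C\<close> commutes with every
\<open>L(u)\<close>.\<close>

lemma LR_central:
  "comm B RD = 0" "comm C RD = 0" "comm B RE = 0" "comm C RE = 0" "comm D RE = 0"
  unfolding L_defs R_defs
  by (rule LR_vanish[where t = 0]; simp add: L_defs comm_LR_left gen_simps)+

lemma LR_central_swapped:
  "comm D RB = 0" "comm D RC = 0" "comm E RB = 0" "comm E RC = 0" "comm E RD = 0"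
  using LR_central unfolding L_defs R_defs by - (rule LR_zero_swap, assumption)+

text \<open>Here \<open>[C(a, d), L(a)] = C(a, d)\<close> and \<open>[C(a, e), L(a)] = \<gamma> C(a, e)\<close>, while both commute with the
other generators.\<close>

lemma comm_A_RD: "comm A RD = 0" and comm_A_RE: "comm A RE = 0"
proof -
  note * = LR_central_swapped[unfolded L_defs R_defs] LR_central[unfolded L_defs R_defs]
    LR_swap[of "basis_vec gd" "basis_vec ga"] LR_swap[of "basis_vec ge" "basis_vec ga"]
  show "comm A RD = 0"
    unfolding L_defs R_defs
    by (rule LR_vanish[where t = 1]; simp add: L_defs comm_LR_left gen_simps * LR_same sc_one)
  show "comm A RE = 0"
    unfolding L_defs R_defs
    by (rule LR_vanish[where t = \<gamma>]; simp add: L_defs comm_LR_left gen_simps * LR_same sc_one)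
qed

lemma LR_swapped: "comm D RA = 0" "comm E RA = 0" "comm A RA = 0" "comm B RB = 0" "comm C RC = 0" "comm D RD = 0" "comm E RE = 0"
  "comm B RA = - P" "comm C RA = - Q"
  using comm_A_RD comm_A_RE unfolding L_defs R_defs P_def Q_def
  by - ((rule LR_zero_swap, assumption | rule LR_same | rule LR_swap)+)

lemmas LR_zero = LR_central LR_central_swapped comm_A_RD comm_A_RE LR_swapped

lemma double_eq_sc: "T + T = sc 2 * T" for T :: "('x, 'f) lin_op"
  by (rule lin_op_eqI, rule poly_mapping_eqI) (simp add: app_simps app_sc lookup_add)

lemma RL_comms:
  "comm RA A = 0" "comm RA B = P" "comm RA C = Q" "comm RA D = 0" "comm RA E = 0"
  "comm RB A = - P" "comm RB B = 0" "comm RB D = 0" "comm RB E = 0"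
  "comm RC A = - Q" "comm RC C = 0" "comm RC D = 0" "comm RC E = 0"
  "comm RD A = 0" "comm RD B = 0" "comm RD C = 0" "comm RD D = 0" "comm RD E = 0"
  "comm RE A = 0" "comm RE B = 0" "comm RE C = 0" "comm RE D = 0" "comm RE E = 0"
  using LR_zero unfolding L_defs R_defs P_def Q_def by (simp_all only: comm_RL)

lemma LL_comms:
  "comm A D = D" "comm A E = sc \<gamma> * E"
  "comm B D = 0" "comm B E = 0" "comm C D = 0" "comm C E = 0" "comm D E = 0"
  "comm A B = - B - sc 2 * P" "comm A C = - C - sc 2 * Q"
  using LR_zero P_def Q_def unfolding L_defs R_defs by (simp_all add: comm_LL gen_simps double_eq_sc)

text \<open>Both sides kill the unit and have the same commutators with all generators; in particular both have commutator
\<open>- L(d)\<close> with \<open>L(a)\<close>, on the left because \<open>J(b, c, a) = - 6 d\<close>.\<close>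

lemma comm_B_RC: "comm B RC = D - RD"
proof -
  have DA: "comm D A = - D" "comm D B = 0" "comm D C = 0" "comm D E = 0"
    using LL_comms comm_swap[of D A] comm_swap[of D B] comm_swap[of D C] comm_swap[of D E] by simp_all
  note * = LR_zero[unfolded L_defs R_defs]
  note ** = RL_comms[unfolded L_defs R_defs] DA[unfolded L_defs] LL_comms[unfolded L_defs]
  have "comm B RC - (D - RD) = 0"
  proof (rule vanish_on_generators[where t = 0])
    show "app (comm B RC - (D - RD)) one = 0"
      unfolding L_defs R_defs app_simps LR_one by (simp add: app_Lop app_Rop mul_one one_h)
    show "app (comm B RC - (D - RD)) (mul one x) = app (comm B RC - (D - RD)) x" for x
      unfolding L_defs R_defs app_simps LR_absorb by (simp add: app_Lop app_Rop one_mul_left one_mul_right)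
    show "comm (comm B RC - (D - RD)) A = sc 0 * (comm B RC - (D - RD))"
      unfolding L_defs R_defs comm_diff_left comm_LR_left
      by (simp add: gen_simps * ** sc_minus sc_one)
    show "comm (comm B RC - (D - RD)) B = 0" "comm (comm B RC - (D - RD)) C = 0"
      "comm (comm B RC - (D - RD)) D = 0" "comm (comm B RC - (D - RD)) E = 0"
      unfolding L_defs R_defs comm_diff_left comm_LR_left
      by (simp_all add: gen_simps * ** comm_self)
  qed
  then show ?thesis by simp
qed

lemma comm_C_RB: "comm C RB = RD - D"
  using LR_swap[of "basis_vec gc" "basis_vec gb"] comm_B_RC unfolding L_defs R_defs by simp

lemma comm_RB_C: "comm RB C = D - RD"
  using comm_B_RC comm_RL unfolding L_defs R_defs by simp

lemma comm_B_C: "comm B C = sc 2 * RD"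
  using comm_B_RC[unfolded L_defs R_defs]
  unfolding L_defs R_defs by (simp only: comm_LL gen_simps double_eq_sc) (simp add: algebra_simps)

lemma P_comms: "comm P A = - P" "comm P B = 0" "comm P C = - RD" "comm P D = 0" "comm P E = 0"
  and Q_comms: "comm Q A = - Q" "comm Q B = RD" "comm Q C = 0" "comm Q D = 0" "comm Q E = 0"
  and RA_comms: "comm RA P = - P" "comm RA Q = - Q" "comm RA RD = - RD"
proof -
  note * = LR_zero[unfolded P_def Q_def L_defs R_defs] comm_B_RC[unfolded L_defs R_defs] comm_C_RB[unfolded L_defs R_defs]
  show "comm P A = - P" "comm P B = 0" "comm P C = - RD" "comm P D = 0" "comm P E = 0"
   "comm Q A = - Q" "comm Q B = RD" "comm Q C = 0" "comm Q D = 0" "comm Q E = 0"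
    unfolding P_def Q_def L_defs R_defs
    by (simp_all add: comm_LR_left gen_simps * sc_one sc_minus)
  have "comm P RA = P" "comm Q RA = Q"
    unfolding P_def Q_def L_defs R_defs
    by (simp_all add: comm_LR_right gen_simps * sc_one sc_minus)
  then show "comm RA P = - P" "comm RA Q = - Q"
    using comm_swap[of RA] by simp_all
  show "comm RA RD = - RD"
    using LR_zero unfolding L_defs R_defs by (simp add: comm_RR gen_simps)
qed

end

section \<open>The action of the generators on left-tapped monomials\<close>

context env_M
begin

definition base where "base j k l m = app (B ^ j * C ^ k * D ^ l * E ^ m) one"

text \<open>\<open>(a + t)\<^sup>i b\<^sup>j c\<^sup>k d\<^sup>l e\<^sup>m\<close>, the left-tapped monomial shifted by \<open>t\<close> in the variable \<open>a\<close>. The shift parameter makes the family stable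
under all multiplication operators, up to linear combinations.\<close>

definition mon where "mon t i j k l m = app ((A + sc t) ^ i) (base j k l m)"

lemma mon_0: "mon t 0 j k l m = base j k l m"
  by (simp add: mon_def app_simps)

lemma mon_Suc: "mon t (Suc i) j k l m = app (A + sc t) (mon t i j k l m)"
  by (simp add: mon_def app_simps)

lemma app_past_power:
  assumes "comm T S = 0"
  shows "app T (app (S ^ n) u) = app (S ^ n) (app T u)"
proof -
  have "T * S ^ n = S ^ n * T" using comm_power_0[OF assms, of n] by (simp add: comm_def)
  then show ?thesis by (simp only: app_simps(6)[symmetric])
qed

lemma base_eq: "base j k l m = app (B ^ j) (app (C ^ k) (app (D ^ l) (app (E ^ m) one)))"
  by (simp add: base_def app_simps)

lemma app_Suc: "app T (app (T ^ n) u) = app (T ^ Suc n) u"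
  by (simp add: app_simps)

lemma D_comms: "comm D B = 0" "comm D C = 0" "comm D A = - D" "comm E B = 0" "comm E C = 0" "comm E D = 0"
  "comm E A = - (sc \<gamma> * E)" "comm B A = B + sc 2 * P" "comm C A = C + sc 2 * Q" "comm C B = - (sc 2 * RD)"
  by (subst comm_swap; simp add: LL_comms comm_B_C)+

lemma RD_one: "app RD one = app D one"
  by (simp add: RD_def D_def app_Lop app_Rop mul_one)

lemma PQ_one: "app P one = 0" "app Q one = 0"
  unfolding P_def Q_def A_def RB_def RC_def by (rule LR_one)+

lemma B_base: "app B (base j k l m) = base (Suc j) k l m"
  by (simp add: base_eq app_Suc)

lemma D_base: "app D (base j k l m) = base j k (Suc l) m"
  by (simp add: base_eq app_past_power D_comms app_Suc del: power_Suc)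

lemma E_base: "app E (base j k l m) = base j k l (Suc m)"
  by (simp add: base_eq app_past_power D_comms app_Suc del: power_Suc)

lemma RD_base: "app RD (base j k l m) = base j k (Suc l) m"
proof -
  have E: "app (E ^ m) (app D one) = app D (app (E ^ m) one)"
    by (rule app_past_power[symmetric]) (rule LL_comms)
  have D: "app (D ^ l) (app D u) = app (D ^ Suc l) u" for u
    by (simp only: power_Suc2 app_simps)
  show ?thesis
    by (simp only: base_eq app_past_power RL_comms RD_one E D)
qed

lemma app_past_power_comm:
  assumes "comm (comm T S) S = 0"
  shows "app T (app (S ^ n) u) = app (S ^ n) (app T u) + scal (of_nat n) (app (S ^ (n - 1)) (app (comm T S) u))"
proof -
  have "app T (app (S ^ n) u) = app (T * S ^ n) u" by (simp add: app_simps)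
  also have "T * S ^ n = S ^ n * T + of_nat n * S ^ (n - 1) * comm T S"
    unfolding comm_power[OF assms, symmetric] by (simp add: comm_def)
  finally show ?thesis by (simp add: app_simps app_of_nat mult.assoc)
qed

lemma C_base: "app C (base j k l m) = base j (Suc k) l m - scal (of_nat (2 * j)) (base (j - 1) k (Suc l) m)"
proof -
  have "app C (base j k l m) = base j (Suc k) l m
      + scal (of_nat j) (app (B ^ (j - 1)) (app (comm C B) (base 0 k l m)))"
    by (simp add: base_eq app_past_power_comm D_comms comm_minus_left comm_sc RL_comms app_Suc app_simps del: power_Suc)
  also have "app (comm C B) (base 0 k l m) = - scal 2 (base 0 k (Suc l) m)"
    by (simp add: D_comms app_simps app_sc RD_base)
  also have "app (B ^ (j - 1)) (- scal 2 (base 0 k (Suc l) m)) = - scal 2 (base (j - 1) k (Suc l) m)"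
    by (simp add: app_minus app_scal base_eq app_simps)
  finally show ?thesis
    by (simp add: scal_minus_right scal_scal mult.commute)
qed

lemma P_base: "app P (base j k l m) = - scal (of_nat k) (base j (k - 1) (Suc l) m)"
proof -
  have "app P (base j k l m) = app (B ^ j) (scal (of_nat k) (app (C ^ (k - 1)) (app (comm P C) (base 0 0 l m))))"
    by (simp add: base_eq app_past_power_comm[of P C] app_past_power P_comms comm_minus_left RL_comms app_simps PQ_one app_zero)
  also have "app (comm P C) (base 0 0 l m) = - base 0 0 (Suc l) m"
    by (simp add: P_comms app_simps RD_base)
  finally show ?thesis
    by (simp add: app_minus app_scal scal_minus_right base_eq app_simps)
qed

lemma Q_base: "app Q (base j k l m) = scal (of_nat j) (base (j - 1) k (Suc l) m)"
proof -
  have "app Q (base j k l m) = scal (of_nat j) (app (B ^ (j - 1)) (app (comm Q B) (base 0 k l m)))"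
    by (simp add: base_eq app_past_power_comm[of Q B] app_past_power Q_comms RL_comms app_simps PQ_one app_zero)
  also have "app (comm Q B) (base 0 k l m) = base 0 k (Suc l) m"
    by (simp add: Q_comms app_simps RD_base)
  finally show ?thesis
    by (simp add: base_eq app_simps)
qed

text \<open>An eigenoperator of \<open>[-, L(a)]\<close> acts on the variable \<open>a\<close> as a shift.\<close>

lemma app_past_shift:
  assumes "comm T A = sc u * T"
  shows "app T (app ((A + sc t) ^ i) v) = app ((A + sc (t + u)) ^ i) (app T v)"
proof (induction i)
  case 0
  show ?case by (simp add: app_simps)
next
  case (Suc i)
  have T: "T * (A + sc t) = (A + sc (t + u)) * T"
    using assms by (simp add: comm_def diff_eq_eq distrib_left distrib_right sc_add sc_commute add_ac)
  have "app T (app ((A + sc t) ^ Suc i) v) = app (T * (A + sc t)) (app ((A + sc t) ^ i) v)"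
    by (simp add: app_simps)
  also have "\<dots> = app (A + sc (t + u)) (app ((A + sc (t + u)) ^ i) (app T v))"
    unfolding T by (simp only: app_simps Suc.IH)
  finally show ?case by (simp only: app_simps power_Suc)
qed

lemma RD_mon: "app RD (mon t i j k l m) = mon t i j k (Suc l) m"
  using app_past_shift[of RD 0] by (simp add: mon_def RD_base RL_comms sc_zero)

lemma D_mon: "app D (mon t i j k l m) = mon (t - 1) i j k (Suc l) m"
  using app_past_shift[of D "-1"] by (simp add: mon_def D_base D_comms sc_minus sc_one)

lemma E_mon: "app E (mon t i j k l m) = mon (t - \<gamma>) i j k l (Suc m)"
  using app_past_shift[of E "-\<gamma>"] by (simp add: mon_def E_base D_comms sc_minus)

lemma P_mon: "app P (mon t i j k l m) = - scal (of_nat k) (mon (t - 1) i j (k - 1) (Suc l) m)"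
  using app_past_shift[of P "-1"] by (simp add: mon_def P_base P_comms sc_minus sc_one app_minus app_scal)

lemma Q_mon: "app Q (mon t i j k l m) = scal (of_nat j) (mon (t - 1) i (j - 1) k (Suc l) m)"
  using app_past_shift[of Q "-1"] by (simp add: mon_def Q_base Q_comms sc_minus sc_one app_minus app_scal)

text \<open>This is \<open>b S + d \<partial>c (S\<^sup>-\<^sup>1 - S)\<close> in terms of the shift. It follows by moving \<open>L(b)\<close> past the factors
\<open>a + t\<close> with \<open>[L(b), L(a)] = L(b) + 2 P\<close>; the two terms with \<open>\<partial>c\<close> cancel when there is no factor \<open>a\<close>.\<close>

lemma B_mon: "app B (mon t i j k l m) = mon (t + 1) i (Suc j) k l m
   + scal (of_nat k) (mon (t - 1) i j (k - 1) (Suc l) m) - scal (of_nat k) (mon (t + 1) i j (k - 1) (Suc l) m)"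
proof (induction i)
  case 0
  show ?case by (simp add: mon_0 B_base)
next
  case (Suc i)
  have B: "B * (A + sc t) = (A + sc (t + 1)) * B + sc 2 * P"
    using D_comms(8) by (simp add: comm_def diff_eq_eq distrib_left distrib_right sc_add sc_one sc_commute add_ac)
  have s: "app (A + sc (t + 1)) (mon (t - 1) i j' k' l' m)
      = mon (t - 1) (Suc i) j' k' l' m + scal 2 (mon (t - 1) i j' k' l' m)" for j' k' l'
    by (simp add: mon_Suc app_simps app_sc scal_add_left[symmetric] add.assoc)
  have "app B (mon t (Suc i) j k l m) = app (B * (A + sc t)) (mon t i j k l m)"
    by (simp add: mon_Suc app_simps)
  also have "\<dots> = app (A + sc (t + 1)) (app B (mon t i j k l m)) + scal 2 (app P (mon t i j k l m))"
    unfolding B by (simp only: app_simps app_sc)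
  finally show ?case
    by (simp add: Suc.IH P_mon s app_add app_diff app_scal mon_Suc[symmetric] scal_add_right
       scal_minus_right scal_scal mult.commute)
qed

text \<open>This is \<open>c S - d \<partial>b (S\<^sup>-\<^sup>1 + S)\<close>. Unlike for \<open>L(b)\<close>, the derivative terms survive when there is no factor
\<open>a\<close>, since \<open>L(c)\<close> has to be moved past the factors \<open>L(b)\<close>, with \<open>[L(c), L(b)] = - 2 R(d)\<close>.\<close>

lemma C_mon: "app C (mon t i j k l m) = mon (t + 1) i j (Suc k) l m
   - scal (of_nat j) (mon (t - 1) i (j - 1) k (Suc l) m) - scal (of_nat j) (mon (t + 1) i (j - 1) k (Suc l) m)"
proof (induction i)
  case 0
  have "scal (of_nat (2 * j)) v = scal (of_nat j) v + scal (of_nat j) v" for v :: "'x \<Rightarrow>\<^sub>0 'f"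
    by (simp add: scal_add_left[symmetric])
  then show ?case by (simp only: mon_0 C_base) (simp add: algebra_simps)
next
  case (Suc i)
  have C: "C * (A + sc t) = (A + sc (t + 1)) * C + sc 2 * Q"
    using D_comms(9) by (simp add: comm_def diff_eq_eq distrib_left distrib_right sc_add sc_one sc_commute add_ac)
  have s: "app (A + sc (t + 1)) (mon (t - 1) i j' k' l' m)
      = mon (t - 1) (Suc i) j' k' l' m + scal 2 (mon (t - 1) i j' k' l' m)" for j' k' l'
    by (simp add: mon_Suc app_simps app_sc scal_add_left[symmetric] add.assoc)
  have "app C (mon t (Suc i) j k l m) = app (C * (A + sc t)) (mon t i j k l m)"
    by (simp add: mon_Suc app_simps)
  also have "\<dots> = app (A + sc (t + 1)) (app C (mon t i j k l m)) + scal 2 (app Q (mon t i j k l m))"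
    unfolding C by (simp only: app_simps app_sc)
  finally show ?case
    by (simp add: Suc.IH Q_mon s app_add app_diff app_scal mon_Suc[symmetric] scal_add_right
       scal_minus_right scal_scal mult.commute)
qed

lemma RD_power_mon: "app (RD ^ n) (mon t i j k l m) = mon t i j k (l + n) m"
  by (induction n) (simp_all add: app_simps RD_mon)

lemma D_power_mon: "app (D ^ n) (mon t i j k l m) = mon (t - of_nat n) i j k (l + n) m"
  by (induction n) (simp_all add: app_simps D_mon algebra_simps)

lemma E_power_mon: "app (E ^ n) (mon t i j k l m) = mon (t - of_nat n * \<gamma>) i j k l (m + n)"
  by (induction n) (simp_all add: app_simps E_mon algebra_simps)

lemma P_power_mon: "app (P ^ n) (mon t i j k l m)
    = scal ((- 1) ^ n * falling_factorial k n) (mon (t - of_nat n) i j (k - n) (l + n) m)"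
  by (induction n)
    (simp_all add: app_simps P_mon app_scal scal_scal scal_one falling_factorial_0 falling_factorial_Suc
      scal_minus_right scal_minus_left algebra_simps)

lemma Q_power_mon: "app (Q ^ n) (mon t i j k l m)
    = scal (falling_factorial j n) (mon (t - of_nat n) i (j - n) k (l + n) m)"
  by (induction n)
    (simp_all add: app_simps Q_mon app_scal scal_scal scal_one falling_factorial_0 falling_factorial_Suc
      algebra_simps)

text \<open>The three summands of \<open>L(b)\<close> commute as operators on polynomials; \<open>v x y z\<close> is the result of applying them
\<open>x\<close>, \<open>y\<close> and \<open>z\<close> times. The shift by \<open>x - y + z\<close> becomes \<open>N - 2 y\<close>.\<close>

lemma B_power_mon: "app (B ^ N) (mon t i j k l m) =
    (\<Sum>x\<le>N. \<Sum>y\<le>N - x. scal (of_nat ((N choose x) * (N - x choose y)) * (- 1) ^ (N - x - y) * falling_factorial k (N - x))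
      (mon (t + of_nat N - 2 * of_nat y) i (j + x) (k - (N - x)) (l + (N - x)) m))"
proof -
  define v where "v x y z = scal ((- 1) ^ z * falling_factorial k (y + z))
    (mon (t + of_nat x - of_nat y + of_nat z) i (j + x) (k - (y + z)) (l + (y + z)) m)" for x y z
  have "app (B ^ N) (mon t i j k l m) = (app B ^^ N) (v 0 0 0)"
    by (simp add: app_power v_def falling_factorial_0 scal_one)
  also have "\<dots> = (\<Sum>x\<le>N. \<Sum>y\<le>N - x. scal (of_nat ((N choose x) * (N - x choose y))) (v x y (N - x - y)))"
  proof (rule vec.trinomial_iterate)
    show "app B (v x y z) = v (Suc x) y z + v x (Suc y) z + v x y (Suc z)" for x y z
      by (simp add: v_def app_scal B_mon scal_add_right scal_diff_right scal_scal falling_factorial_Suc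
          scal_minus_left algebra_simps)
  qed (simp_all add: app_add app_scal)
  finally show ?thesis
  proof (rule trans, intro sum.cong refl)
    fix x y assume "x \<in> {..N}" "y \<in> {..N - x}"
    then have xy: "x \<le> N" "y \<le> N - x" by simp_all
    then have "y + (N - x - y) = N - x" by simp
    moreover have "t + of_nat x - of_nat y + of_nat (N - x - y) = (t + of_nat N - 2 * of_nat y :: 'f)"
      using xy by (simp add: of_nat_diff)
    ultimately show "scal (of_nat ((N choose x) * (N - x choose y))) (v x y (N - x - y))
      = scal (of_nat ((N choose x) * (N - x choose y)) * (- 1) ^ (N - x - y) * falling_factorial k (N - x))
      (mon (t + of_nat N - 2 * of_nat y) i (j + x) (k - (N - x)) (l + (N - x)) m)"
      by (simp only: v_def scal_scal mult.assoc)
  qed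
qed

lemma C_power_mon: "app (C ^ N) (mon t i j k l m) =
    (\<Sum>x\<le>N. \<Sum>y\<le>N - x. scal (of_nat ((N choose x) * (N - x choose y)) * (- 1) ^ (N - x) * falling_factorial j (N - x))
      (mon (t + of_nat N - 2 * of_nat y) i (j - (N - x)) (k + x) (l + (N - x)) m))"
proof -
  define v where "v x y z = scal ((- 1) ^ (y + z) * falling_factorial j (y + z))
    (mon (t + of_nat x - of_nat y + of_nat z) i (j - (y + z)) (k + x) (l + (y + z)) m)" for x y z
  have "app (C ^ N) (mon t i j k l m) = (app C ^^ N) (v 0 0 0)"
    by (simp add: app_power v_def falling_factorial_0 scal_one)
  also have "\<dots> = (\<Sum>x\<le>N. \<Sum>y\<le>N - x. scal (of_nat ((N choose x) * (N - x choose y))) (v x y (N - x - y)))"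
  proof (rule vec.trinomial_iterate)
    show "app C (v x y z) = v (Suc x) y z + v x (Suc y) z + v x y (Suc z)" for x y z
      by (simp add: v_def app_scal C_mon scal_add_right scal_diff_right scal_scal falling_factorial_Suc
          scal_minus_left algebra_simps)
  qed (simp_all add: app_add app_scal)
  finally show ?thesis
  proof (rule trans, intro sum.cong refl)
    fix x y assume "x \<in> {..N}" "y \<in> {..N - x}"
    then have xy: "x \<le> N" "y \<le> N - x" by simp_all
    then have "y + (N - x - y) = N - x" by simp
    moreover have "t + of_nat x - of_nat y + of_nat (N - x - y) = (t + of_nat N - 2 * of_nat y :: 'f)"
      using xy by (simp add: of_nat_diff)
    ultimately show "scal (of_nat ((N choose x) * (N - x choose y))) (v x y (N - x - y))
      = scal (of_nat ((N choose x) * (N - x choose y)) * (- 1) ^ (N - x) * falling_factorial j (N - x))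
      (mon (t + of_nat N - 2 * of_nat y) i (j - (N - x)) (k + x) (l + (N - x)) m)"
      by (simp only: v_def scal_scal mult.assoc)
  qed
qed

lemma A_power_mon: "app (A ^ n) (mon t i j k l m) =
  (\<Sum>x\<le>i. scal (of_nat (i choose x) * t ^ x) (mon 0 (i + n - x) j k l m))"
proof -
  let ?w = "\<lambda>x y. scal (t ^ x) (app (A ^ y) (base j k l m))"
  have "mon t i j k l m = (app (A + sc t) ^^ i) (?w 0 0)"
    by (simp add: mon_def app_power scal_one app_simps)
  also have "\<dots> = (\<Sum>x\<le>i. scal (of_nat (i choose x)) (?w x (i - x)))"
    by (rule vec.binomial_iterate) (simp_all add: app_add app_scal app_simps app_sc scal_scal algebra_simps)
  finally have mon: "mon t i j k l m = (\<Sum>x\<le>i. scal (of_nat (i choose x)) (?w x (i - x)))" .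
  have A_sum: "app T (sum f S) = (\<Sum>x\<in>S. app T (f x))" for T :: "('x, 'f) lin_op" and f :: "nat \<Rightarrow> 'x \<Rightarrow>\<^sub>0 'f" and S
    by (induction S rule: infinite_finite_induct) (simp_all add: app_zero app_add)
  show ?thesis
    unfolding mon A_sum
  proof (rule sum.cong[OF refl])
    fix x assume "x \<in> {..i}"
    then have "i + n - x = n + (i - x)" by simp
    then show "app (A ^ n) (scal (of_nat (i choose x)) (?w x (i - x)))
        = scal (of_nat (i choose x) * t ^ x) (mon 0 (i + n - x) j k l m)"
      by (simp add: app_scal scal_scal mon_def sc_zero power_add app_simps)
  qed
qed

end

section \<open>Left multiplication by a left-tapped monomial\<close>

text \<open>The map \<open>X \<mapsto> L(s) X + [R(s), X]\<close> that takes left multiplication by \<open>x\<close> to left multiplication by \<open>s x\<close>.\<close>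

definition Phi :: "'r::ring_1 \<Rightarrow> 'r \<Rightarrow> 'r \<Rightarrow> 'r" where
  "Phi T S X = T * X + comm S X"

lemma Phi_iterate_commuting:
  assumes "comm S T = 0" "comm S Y = 0"
  shows "(Phi T S ^^ n) Y = T ^ n * Y"
  by (induction n) (simp_all add: Phi_def comm_mult comm_power_0 comm_zero assms mult.assoc)

lemma Phi_add: "Phi T S (X + Y) = Phi T S X + Phi T S Y"
  by (simp add: Phi_def comm_add_right algebra_simps)

lemma Phi_sc: "Phi T S (sc c * X) = sc c * Phi T S X"
  by (simp add: Phi_def comm_sc sc_left_commute distrib_left)

lemma Phi_iterate_sum: "(Phi T S ^^ n) (sum X I) = (\<Sum>x\<in>I. (Phi T S ^^ n) (X x))"
proof -
  have zero: "Phi T S 0 = 0" by (simp add: Phi_def comm_zero)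
  have T_sum: "Phi T S (sum f I) = (\<Sum>x\<in>I. Phi T S (f x))" for f
    by (induction I rule: infinite_finite_induct) (simp_all add: zero Phi_add)
  show ?thesis by (induction n) (simp_all add: T_sum)
qed

lemma Phi_iterate_sc: "(Phi T S ^^ n) (sc c * X) = sc c * (Phi T S ^^ n) X"
  by (induction n) (simp_all add: Phi_sc)

text \<open>With \<open>[S, X] = Y\<close> and \<open>[S, Y] = - Y\<close>, the flow of \<open>[S, -]\<close> maps \<open>X\<close> to \<open>X + (1 - exp(-t)) Y\<close>, and \<open>U \<epsilon>\<close> is
the coefficient of \<open>(1 - exp(-t))\<^sup>\<epsilon>\<close> in the image of \<open>X\<^sup>J\<close>. The equation is the infinitesimal form of this, the same as for
\<open>Stirling_iterate\<close>.\<close>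

lemma comm_divided_power:
  fixes X Y S :: "('x, 'f::field_char_0) lin_op" and J :: nat
  assumes "comm S X = Y" and "comm Y X = 0" and "comm S Y = - Y"
  defines "U \<equiv> \<lambda>\<epsilon>. sc (of_nat (J choose \<epsilon>)) * (X ^ (J - \<epsilon>) * Y ^ \<epsilon>)"
  shows "comm S (U \<epsilon>) = sc (of_nat (Suc \<epsilon>)) * U (Suc \<epsilon>) - sc (of_nat \<epsilon>) * U \<epsilon>"
proof -
  have X: "comm S (X ^ n) = sc (of_nat n) * (X ^ (n - 1) * Y)" for n
    using assms(1,2) by (simp add: comm_power sc_of_nat mult.assoc)
  have Y: "comm S (Y ^ n) = - (sc (of_nat n) * Y ^ n)" for n
  proof -
    have Y: "comm S (Y ^ n) = of_nat n * Y ^ (n - 1) * (- Y)"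
      using comm_power[of S Y n] by (simp add: assms(3) comm_minus_left comm_self)
    show ?thesis
    proof (cases n)
      case (Suc n')
      show ?thesis
        unfolding Y by (simp only: Suc sc_of_nat diff_Suc_1 mult_minus_right power_Suc2 mult.assoc)
    qed (simp add: comm_one sc_zero)
  qed
  have XY: "comm S (X ^ (J - \<epsilon>) * Y ^ \<epsilon>) = sc (of_nat (J - \<epsilon>)) * (X ^ (J - \<epsilon> - 1) * Y ^ Suc \<epsilon>)
      - sc (of_nat \<epsilon>) * (X ^ (J - \<epsilon>) * Y ^ \<epsilon>)"
    by (simp add: comm_mult X Y sc_left_commute[of "X ^ (J - \<epsilon>)"] mult.assoc)
  have "comm S (U \<epsilon>) = sc (of_nat ((J choose \<epsilon>) * (J - \<epsilon>))) * (X ^ (J - \<epsilon> - 1) * Y ^ Suc \<epsilon>)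
      - sc (of_nat \<epsilon>) * U \<epsilon>"
    by (simp only: U_def comm_sc XY right_diff_distrib of_nat_mult sc_mult mult.assoc
        sc_left_commute[of "sc (of_nat \<epsilon>)"])
  also have "sc (of_nat ((J choose \<epsilon>) * (J - \<epsilon>))) * (X ^ (J - \<epsilon> - 1) * Y ^ Suc \<epsilon>) = sc (of_nat (Suc \<epsilon>)) * U (Suc \<epsilon>)"
    unfolding binomial_choose_Suc by (simp only: U_def of_nat_mult sc_mult mult.assoc diff_diff_left Suc_eq_plus1)
  finally show ?thesis .
qed

text \<open>The product of two such series in \<open>1 - exp(-t)\<close> solves the same differential equation, and \<open>G s\<close> are its coefficients.\<close>

lemma comm_divided_power_pair:
  fixes S :: "('x, 'f::field_char_0) lin_op"
  assumes U: "\<And>\<epsilon>. comm S (U \<epsilon>) = sc (of_nat (Suc \<epsilon>)) * U (Suc \<epsilon>) - sc (of_nat \<epsilon>) * U \<epsilon>"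
    and V: "\<And>\<delta>. comm S (V \<delta>) = sc (of_nat (Suc \<delta>)) * V (Suc \<delta>) - sc (of_nat \<delta>) * V \<delta>"
  defines "G \<equiv> \<lambda>s. \<Sum>\<delta>\<le>s. U (s - \<delta>) * V \<delta>"
  shows "comm S (G s) = sc (of_nat (Suc s)) * G (Suc s) - sc (of_nat s) * G s"
proof -
  have comm_sum: "comm S (sum f X) = (\<Sum>x\<in>X. comm S (f x))" for f :: "nat \<Rightarrow> ('x, 'f) lin_op" and X
    by (induction X rule: infinite_finite_induct) (simp_all add: comm_zero comm_add_right)
  have "comm S (G s) = (\<Sum>\<delta>\<le>s. sc (of_nat (Suc s - \<delta>)) * (U (Suc s - \<delta>) * V \<delta>))
      + (\<Sum>\<delta>\<le>s. sc (of_nat (Suc \<delta>)) * (U (s - \<delta>) * V (Suc \<delta>))) - sc (of_nat s) * G s"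
    unfolding G_def comm_sum sum_distrib_left sum.distrib[symmetric] sum_subtractf[symmetric]
  proof (rule sum.cong[OF refl])
    fix \<delta> assume "\<delta> \<in> {..s}"
    then have \<delta>: "Suc s - \<delta> = Suc (s - \<delta>)" and s: "(of_nat s :: 'f) = of_nat (s - \<delta>) + of_nat \<delta>"
      by (simp_all add: Suc_diff_le of_nat_diff)
    show "comm S (U (s - \<delta>) * V \<delta>) = sc (of_nat (Suc s - \<delta>)) * (U (Suc s - \<delta>) * V \<delta>)
        + sc (of_nat (Suc \<delta>)) * (U (s - \<delta>) * V (Suc \<delta>)) - sc (of_nat s) * (U (s - \<delta>) * V \<delta>)"
      unfolding comm_mult U V \<delta> s sc_add
      by (simp only: right_diff_distrib left_diff_distrib distrib_right distrib_left sc_left_commute mult.assoc)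
         (simp only: algebra_simps)
  qed
  also have "(\<Sum>\<delta>\<le>s. sc (of_nat (Suc s - \<delta>)) * (U (Suc s - \<delta>) * V \<delta>))
      = (\<Sum>\<delta>\<le>Suc s. sc (of_nat (Suc s - \<delta>)) * (U (Suc s - \<delta>) * V \<delta>))"
    by (simp add: sc_zero)
  also have "(\<Sum>\<delta>\<le>s. sc (of_nat (Suc \<delta>)) * (U (s - \<delta>) * V (Suc \<delta>)))
      = (\<Sum>\<delta>\<le>Suc s. sc (of_nat \<delta>) * (U (Suc s - \<delta>) * V \<delta>))"
    by (simp only: sum.atMost_Suc_shift[where n = s]) (simp add: sc_zero)
  also have "(\<Sum>\<delta>\<le>Suc s. sc (of_nat (Suc s - \<delta>)) * (U (Suc s - \<delta>) * V \<delta>)) + \<dots> = sc (of_nat (Suc s)) * G (Suc s)"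
    unfolding G_def sum_distrib_left sum.distrib[symmetric] distrib_right[symmetric] sc_add[symmetric] of_nat_add[symmetric]
    by (rule sum.cong) simp_all
  finally show ?thesis .
qed

context env_M
begin

lemma Lop_power_L: "Lop (app (L s ^ n) x) = (Phi (L s) (R s) ^^ n) (Lop x)"
  by (induction n) (simp_all add: app_simps app_Lop Lop_mul_h Phi_def)

lemma Phi_times_unit: "(Phi (L s) (R s) ^^ n) (X * Lop one) = (Phi (L s) (R s) ^^ n) X * Lop one"
proof -
  have "comm (R s) (Lop one) = 0"
    by (rule lin_op_eqI) (simp add: app_comm app_Lop app_Rop app_simps one_mul one_mul_left)
  then have "Phi (L s) (R s) (Y * Lop one) = Phi (L s) (R s) Y * Lop one" for Y
    by (simp add: Phi_def comm_mult distrib_right mult.assoc)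
  then show ?thesis by (induction n) simp_all
qed

lemma mon_word: "mon 0 i j k l m = app (A ^ i) (app (B ^ j) (app (C ^ k) (app (D ^ l) (app (E ^ m) one))))"
  by (simp add: mon_def sc_zero base_eq)

text \<open>Iterating the recursion for \<open>L(s x)\<close>. For the inner letters \<open>e, d, c\<close> the commutator term vanishes, because
\<open>R(s)\<close> commutes with the operators of its own and of the later letters. The factor \<open>Lop one\<close> is the projection onto the
algebra.\<close>

lemma Lop_mon:
  "Lop (mon 0 i j k l m) = (Phi A RA ^^ i) ((Phi B RB ^^ j) (C ^ k * (D ^ l * E ^ m))) * Lop one"
proof -
  have E: "(Phi E RE ^^ m) 1 = E ^ m"
    using Phi_iterate_commuting[OF RL_comms(23) comm_one] by simp
  have D: "(Phi D RD ^^ l) (E ^ m) = D ^ l * E ^ m"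
    by (simp add: Phi_iterate_commuting RL_comms comm_power_0)
  have C: "(Phi C RC ^^ k) (D ^ l * E ^ m) = C ^ k * (D ^ l * E ^ m)"
    by (simp add: Phi_iterate_commuting RL_comms comm_power_0 comm_mult)
  have "Lop (mon 0 i j k l m) = (Phi A RA ^^ i) ((Phi B RB ^^ j) ((Phi C RC ^^ k)
      ((Phi D RD ^^ l) ((Phi E RE ^^ m) (1 * Lop one)))))"
    unfolding mon_word unfolding L_defs R_defs by (simp only: Lop_power_L mult_1)
  also have "\<dots> = (Phi A RA ^^ i) ((Phi B RB ^^ j) ((Phi C RC ^^ k)
      ((Phi D RD ^^ l) ((Phi E RE ^^ m) 1)))) * Lop one"
    unfolding L_defs R_defs by (simp only: Phi_times_unit)
  finally show ?thesis unfolding E D C .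
qed

lemma unit_mon: "app (Lop one) (mon 0 i j k l m) = mon 0 i j k l m"
proof -
  have "app (Lop one) (app (L s ^ n) x) = app (L s ^ n) x" if "app (Lop one) x = x" for s n x
    using that by (cases n) (simp_all add: app_simps app_Lop one_mul)
  then show ?thesis
    unfolding mon_word L_defs by (simp add: app_Lop one_mul_one)
qed

lemma RB_RD: "comm RB RD = 0"
  unfolding R_defs comm_RR using LR_zero(1) unfolding L_defs R_defs by (simp add: M_bracket_basis R_zero)

text \<open>Since \<open>[R(b), L(c)] = L(d) - R(d)\<close> commutes with \<open>L(c)\<close> and \<open>R(b)\<close>, the derivation \<open>[R(b), -]\<close> acts on
powers of \<open>L(c)\<close> like differentiation; this produces the falling factorial.\<close>

lemma Phi_B_iterate:
  assumes Y: "comm RB Y = 0"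
  shows "(Phi B RB ^^ j) (C ^ k * Y) = (\<Sum>\<alpha>\<le>j. sc (of_nat (j choose \<alpha>) * falling_factorial k \<alpha>)
      * (B ^ (j - \<alpha>) * (C ^ (k - \<alpha>) * ((D - RD) ^ \<alpha> * Y))))"
proof -
  define w where "w \<alpha> x = sc (falling_factorial k \<alpha>) * (B ^ x * (C ^ (k - \<alpha>) * ((D - RD) ^ \<alpha> * Y)))" for \<alpha> x
  have ZC: "comm (D - RD) C = 0" by (simp add: comm_diff_left D_comms RL_comms)
  have RC: "comm RB (C ^ n) = sc (of_nat n) * (C ^ (n - 1) * (D - RD))" for n
    using comm_power[of RB C n] by (simp only: comm_RB_C ZC sc_of_nat mult.assoc)
  have Z: "comm RB ((D - RD) ^ n) = 0" for n
    by (rule comm_power_0) (simp add: comm_diff_right RL_comms RB_RD)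
  have RB: "comm RB (B ^ n) = 0" for n
    by (rule comm_power_0) (rule RL_comms)
  have deriv: "comm RB (B ^ x * (C ^ n * ((D - RD) ^ \<alpha> * Y)))
      = sc (of_nat n) * (B ^ x * (C ^ (n - 1) * ((D - RD) ^ Suc \<alpha> * Y)))" for x n \<alpha>
    by (simp only: comm_mult RB RC Z Y mult_zero_left mult_zero_right add_0_left add_0_right
        sc_left_commute[of "B ^ x"] mult.assoc power_Suc)
  have "B * w \<alpha> x = w \<alpha> (Suc x)" for \<alpha> x
    by (simp only: w_def sc_left_commute[of B] power_Suc[of B] mult.assoc)
  moreover have "comm RB (w \<alpha> x) = w (Suc \<alpha>) x" for \<alpha> x
    by (simp only: w_def comm_sc deriv falling_factorial_Suc sc_mult mult.assoc diff_Suc_eq_diff_pred diff_commute)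
  ultimately have "Phi B RB (w \<alpha> x) = w (Suc \<alpha>) x + w \<alpha> (Suc x)" for \<alpha> x
    by (simp only: Phi_def add.commute)
  from op.binomial_iterate[where T = "Phi B RB" and w = w and n = j, OF Phi_add Phi_sc this]
  show ?thesis
    by (simp only: w_def falling_factorial_0 sc_one sc_mult mult.assoc power_0 mult_1_left diff_zero)
qed

lemma D_minus_RD_power:
  "(D - RD) ^ \<alpha> = (\<Sum>\<beta>\<le>\<alpha>. sc (of_nat (\<alpha> choose \<beta>) * (- 1) ^ (\<alpha> - \<beta>)) * (RD ^ (\<alpha> - \<beta>) * D ^ \<beta>))"
proof -
  let ?w = "\<lambda>x y. sc ((- 1) ^ y) * (RD ^ y * D ^ x)"
  have DR: "D * (RD ^ y * X) = RD ^ y * (D * X)" for y X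
    using comm_power_0[OF LR_swapped(6), of y] by (simp add: comm_def mult.assoc[symmetric])
  have "D * ?w x y = ?w (Suc x) y" for x y
    by (simp only: sc_left_commute[of D] DR power_Suc)
  moreover have "RD * ?w x y = - ?w x (Suc y)" for x y
    by (simp add: sc_left_commute[of RD] sc_minus mult.assoc)
  ultimately have step: "(D - RD) * ?w x y = ?w (Suc x) y + ?w x (Suc y)" for x y
    by (simp only: left_diff_distrib diff_minus_eq_add)
  have "((*) (D - RD) ^^ \<alpha>) (?w 0 0) = (\<Sum>\<beta>\<le>\<alpha>. sc (of_nat (\<alpha> choose \<beta>)) * ?w \<beta> (\<alpha> - \<beta>))"
    by (rule op.binomial_iterate[where T = "(*) (D - RD)" and w = ?w, OF _ _ step]) (simp_all add: distrib_left sc_left_commute[of "D - RD"])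
  moreover have "((*) (D - RD) ^^ \<alpha>) 1 = (D - RD) ^ \<alpha>" by (induction \<alpha>) simp_all
  ultimately show ?thesis
    by (simp only: sc_one sc_mult mult.assoc power_0 mult_1_left)
qed

text \<open>\<open>L(a)\<close> commutes with \<open>R(a)\<close>, so the iterate is a binomial sum of \<open>L(a)\<^sup>\<kappa>\<close> times iterated derivations
\<open>[R(a), -]\<close>, to which the Leibniz rule applies with the eigenvector \<open>V\<close> as one factor.\<close>

lemma Phi_A_iterate:
  assumes V: "comm RA V = sc g * V"
  shows "(Phi A RA ^^ i) (W * V) = (\<Sum>\<kappa>\<le>i. sc (of_nat (i choose \<kappa>)) *
    (A ^ \<kappa> * (\<Sum>\<zeta>\<le>i - \<kappa>. sc (of_nat (i - \<kappa> choose \<zeta>) * g ^ \<zeta>) * ((comm RA ^^ (i - \<kappa> - \<zeta>)) W * V))))"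
proof -
  have A: "comm RA (A ^ \<kappa>) = 0" for \<kappa>
    by (rule comm_power_0) (rule RL_comms)
  have 1: "Phi A RA (A ^ \<kappa> * (comm RA ^^ y) (W * V)) = A ^ Suc \<kappa> * (comm RA ^^ y) (W * V) + A ^ \<kappa> * (comm RA ^^ Suc y) (W * V)"
    for \<kappa> y
    by (simp only: Phi_def comm_mult A mult_zero_left add_0_left power_Suc mult.assoc funpow.simps o_apply)
  have X: "comm RA (sc c * (X * V)) = sc (c * g) * (X * V) + sc c * (comm RA X * V)" for c X
    by (subst comm_sc(2)) (simp only: comm_mult V sc_left_commute[of X] distrib_left sc_mult mult.assoc add.commute)
  have 2: "comm RA (sc (g ^ \<zeta>) * ((comm RA ^^ y) W * V))
     = sc (g ^ Suc \<zeta>) * ((comm RA ^^ y) W * V) + sc (g ^ \<zeta>) * ((comm RA ^^ Suc y) W * V)" for \<zeta> y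
    by (simp only: X power_Suc2 funpow.simps o_apply)
  have 3: "(comm RA ^^ N) (W * V) = (\<Sum>\<zeta>\<le>N. sc (of_nat (N choose \<zeta>) * g ^ \<zeta>) * ((comm RA ^^ (N - \<zeta>)) W * V))" for N
    using op.binomial_iterate[where T = "comm RA" and w = "\<lambda>\<zeta> y. sc (g ^ \<zeta>) * ((comm RA ^^ y) W * V)" and n = N, OF comm_add_right comm_sc(2) 2]
    by (simp only: sc_one sc_mult mult.assoc power_0 mult_1_left funpow_0)
  have "(Phi A RA ^^ i) (W * V)
      = (\<Sum>\<kappa>\<le>i. sc (of_nat (i choose \<kappa>)) * (A ^ \<kappa> * (comm RA ^^ (i - \<kappa>)) (W * V)))"
    using op.binomial_iterate[where T = "Phi A RA" and w = "\<lambda>\<kappa> y. A ^ \<kappa> * (comm RA ^^ y) (W * V)" and n = i, OF Phi_add Phi_sc 1]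
    by (simp only: power_0 mult_1_left funpow_0)
  then show ?thesis by (simp only: 3)
qed

lemma comm_RA_iterate:
  "(comm RA ^^ N) (B ^ J * C ^ K) = (\<Sum>s\<le>N. sc ((- 1) ^ (N - s) * of_nat (fact s * Stirling N s)) *
    (\<Sum>\<delta>\<le>s. sc (of_nat (J choose (s - \<delta>)) * of_nat (K choose \<delta>)) *
      (B ^ (J - (s - \<delta>)) * (P ^ (s - \<delta>) * (C ^ (K - \<delta>) * Q ^ \<delta>)))))"
proof -
  define U where "U \<epsilon> = sc (of_nat (J choose \<epsilon>)) * (B ^ (J - \<epsilon>) * P ^ \<epsilon>)" for \<epsilon>
  define V where "V \<delta> = sc (of_nat (K choose \<delta>)) * (C ^ (K - \<delta>) * Q ^ \<delta>)" for \<delta>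
  define G where "G s = (\<Sum>\<delta>\<le>s. U (s - \<delta>) * V \<delta>)" for s
  have U: "comm RA (U \<epsilon>) = sc (of_nat (Suc \<epsilon>)) * U (Suc \<epsilon>) - sc (of_nat \<epsilon>) * U \<epsilon>" for \<epsilon>
    unfolding U_def by (rule comm_divided_power) (rule RL_comms P_comms RA_comms)+
  have V: "comm RA (V \<delta>) = sc (of_nat (Suc \<delta>)) * V (Suc \<delta>) - sc (of_nat \<delta>) * V \<delta>" for \<delta>
    unfolding V_def by (rule comm_divided_power) (rule RL_comms Q_comms RA_comms)+
  have "comm RA (G s) = sc (of_nat (Suc s)) * G (Suc s) - sc (of_nat s) * G s" for s
    unfolding G_def by (rule comm_divided_power_pair[of RA U V, OF U V])
  from op.Stirling_iterate[where T = "comm RA" and G = G and n = N, OF comm_add_right comm_sc(2) this]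
  have "(comm RA ^^ N) (G 0) = (\<Sum>s\<le>N. sc ((- 1) ^ (N - s) * of_nat (fact s * Stirling N s)) * G s)" .
  moreover have "G 0 = B ^ J * C ^ K" by (simp add: G_def U_def V_def sc_one)
  moreover have "U \<epsilon> * V \<delta> = sc (of_nat (J choose \<epsilon>) * of_nat (K choose \<delta>)) *
      (B ^ (J - \<epsilon>) * (P ^ \<epsilon> * (C ^ (K - \<delta>) * Q ^ \<delta>)))" for \<epsilon> \<delta>
    by (simp only: U_def V_def sc_mult_mult) (simp only: mult.assoc)
  ultimately show ?thesis by (simp only: G_def)
qed

end

lemmas app_dist = app_sum sum_app app_scal app_simps(6) app_sc scal_scal vec.scale_sum_right

context env_M
begin

text \<open>The iteration for the letters \<open>b, c, d, e\<close> of the left factor is carried out, with sums over \<open>\<alpha>\<close> and \<open>\<beta>\<close>; the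
iteration for \<open>a\<close> is still pending.\<close>

lemma mul_mon_Phi:
  "mul (mon 0 i j k l m) (mon 0 r n p q s) = (\<Sum>\<alpha>\<le>j. \<Sum>\<beta>\<le>\<alpha>.
     scal (of_nat (j choose \<alpha>) * falling_factorial k \<alpha> * (of_nat (\<alpha> choose \<beta>) * (- 1) ^ (\<alpha> - \<beta>)))
       (app ((Phi A RA ^^ i) (B ^ (j - \<alpha>) * C ^ (k - \<alpha>) * (RD ^ (\<alpha> - \<beta>) * (D ^ \<beta> * (D ^ l * E ^ m)))))
         (mon 0 r n p q s)))"
proof -
  have Y: "comm RB (D ^ l * E ^ m) = 0"
    by (simp add: comm_mult comm_power_0 RL_comms)
  have BC: "B ^ x * (C ^ y * ((D - RD) ^ \<alpha> * Y))
      = (\<Sum>\<beta>\<le>\<alpha>. sc (of_nat (\<alpha> choose \<beta>) * (- 1) ^ (\<alpha> - \<beta>)) * (B ^ x * C ^ y * (RD ^ (\<alpha> - \<beta>) * (D ^ \<beta> * Y))))"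
    for x y \<alpha> Y
    by (simp only: D_minus_RD_power sum_distrib_left sum_distrib_right mult.assoc sc_left_commute[of "B ^ x"] sc_left_commute[of "C ^ y"])
  have "mul (mon 0 i j k l m) (mon 0 r n p q s) = app (Lop (mon 0 i j k l m)) (mon 0 r n p q s)"
    by (simp only: app_Lop)
  also have "\<dots> = app ((Phi A RA ^^ i) ((Phi B RB ^^ j) (C ^ k * (D ^ l * E ^ m)))) (mon 0 r n p q s)"
    by (simp only: Lop_mon app_simps(6) unit_mon)
  also have "\<dots> = (\<Sum>\<alpha>\<le>j. \<Sum>\<beta>\<le>\<alpha>.
     scal (of_nat (j choose \<alpha>) * falling_factorial k \<alpha> * (of_nat (\<alpha> choose \<beta>) * (- 1) ^ (\<alpha> - \<beta>)))
       (app ((Phi A RA ^^ i) (B ^ (j - \<alpha>) * C ^ (k - \<alpha>) * (RD ^ (\<alpha> - \<beta>) * (D ^ \<beta> * (D ^ l * E ^ m)))))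
         (mon 0 r n p q s)))"
    by (simp only: Phi_B_iterate[OF Y] BC Phi_iterate_sum Phi_iterate_sc app_dist)
      (simp only: mult.assoc mult.commute mult.left_commute)
  finally show ?thesis .
qed

lemma Phi_A_expand:
  assumes V: "comm RA V = sc g * V"
  shows "app ((Phi A RA ^^ i) (B ^ J * C ^ K * V)) v = (\<Sum>\<kappa>\<le>i. \<Sum>\<delta>\<le>i - \<kappa>. \<Sum>\<epsilon>\<le>i - \<kappa> - \<delta>. \<Sum>\<zeta>\<le>i - \<kappa> - \<delta> - \<epsilon>.
    scal (of_nat (i choose \<kappa>) * (of_nat (i - \<kappa> choose \<zeta>) * g ^ \<zeta> * ((- 1) ^ (i - \<kappa> - \<zeta> - (\<delta> + \<epsilon>))
        * of_nat (fact (\<delta> + \<epsilon>) * Stirling (i - \<kappa> - \<zeta>) (\<delta> + \<epsilon>)) * (of_nat (J choose \<epsilon>) * of_nat (K choose \<delta>)))))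
      (app (A ^ \<kappa>) (app (B ^ (J - \<epsilon>)) (app (P ^ \<epsilon>) (app (C ^ (K - \<delta>)) (app (Q ^ \<delta>) (app V v)))))))"
proof -
  have "app ((Phi A RA ^^ i) (B ^ J * C ^ K * V)) v = (\<Sum>\<kappa>\<le>i. \<Sum>\<zeta>\<le>i - \<kappa>. \<Sum>s\<le>i - \<kappa> - \<zeta>. \<Sum>\<delta>\<le>s.
    scal (of_nat (i choose \<kappa>) * (of_nat (i - \<kappa> choose \<zeta>) * g ^ \<zeta> * ((- 1) ^ (i - \<kappa> - \<zeta> - s)
        * of_nat (fact s * Stirling (i - \<kappa> - \<zeta>) s) * (of_nat (J choose (s - \<delta>)) * of_nat (K choose \<delta>)))))
      (app (A ^ \<kappa>) (app (B ^ (J - (s - \<delta>))) (app (P ^ (s - \<delta>)) (app (C ^ (K - \<delta>)) (app (Q ^ \<delta>) (app V v)))))))"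
    unfolding Phi_A_iterate[OF V] comm_RA_iterate
    by (simp only: app_dist) (simp only: mult.assoc mult.commute mult.left_commute)
  then show ?thesis by (simp only: sum_triangle add_diff_cancel_left')
qed

lemma nilpotent_word_mon:
  "app (RD ^ (\<alpha> - \<beta>) * (D ^ \<beta> * (D ^ l * E ^ m))) (mon 0 r n p q s)
    = mon (0 - of_nat m * \<gamma> - of_nat l - of_nat \<beta>) r n p (q + l + \<beta> + (\<alpha> - \<beta>)) (s + m)"
  by (simp only: app_simps RD_power_mon D_power_mon E_power_mon)

lemma comm_RA_weight:
  "comm RA (RD ^ g * (D ^ \<beta> * (D ^ l * E ^ m))) = sc (- of_nat g) * (RD ^ g * (D ^ \<beta> * (D ^ l * E ^ m)))"
proof -
  have RD: "comm RA (RD ^ g) = sc (- of_nat g) * RD ^ g"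
  proof (induction g)
    case (Suc g)
    show ?case
      by (simp only: power_Suc comm_mult Suc.IH RA_comms sc_left_commute[of RD])
        (simp add: sc_diff sc_minus sc_one left_diff_distrib)
  qed (simp add: comm_one sc_zero)
  have "comm RA (D ^ \<beta> * (D ^ l * E ^ m)) = 0"
    by (simp add: comm_mult comm_power_0 RL_comms)
  then show ?thesis by (simp only: comm_mult[of _ "RD ^ g"] RD mult_zero_right add_0_right mult.assoc)
qed

text \<open>Applying the operators from right to left gives the sums over \<open>\<lambda>, \<mu>\<close> outside those over \<open>\<eta>, \<theta>\<close>; the index
ranges of the two pairs are independent of each other, so they can be exchanged.\<close>

lemma ABPCQ_word_mon:
  "app (A ^ \<kappa>) (app (B ^ J) (app (P ^ \<epsilon>) (app (C ^ K) (app (Q ^ \<delta>) (mon t r n p q s)))))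
    = (\<Sum>\<eta>\<le>J. \<Sum>\<theta>\<le>J - \<eta>. \<Sum>lam\<le>K. \<Sum>\<mu>\<le>K - lam. \<Sum>\<nu>\<le>r.
      scal (falling_factorial n \<delta> * (of_nat ((K choose lam) * (K - lam choose \<mu>)) * (- 1) ^ (K - lam) * falling_factorial (n - \<delta>) (K - lam))
         * ((- 1) ^ \<epsilon> * falling_factorial (p + lam) \<epsilon>)
         * (of_nat ((J choose \<eta>) * (J - \<eta> choose \<theta>)) * (- 1) ^ (J - \<eta> - \<theta>) * falling_factorial (p + lam - \<epsilon>) (J - \<eta>))
         * (of_nat (r choose \<nu>) * (t - of_nat \<delta> + of_nat K - 2 * of_nat \<mu> - of_nat \<epsilon> + of_nat J - 2 * of_nat \<theta>) ^ \<nu>))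
        (mon 0 (r + \<kappa> - \<nu>) (n - \<delta> - (K - lam) + \<eta>) (p + lam - \<epsilon> - (J - \<eta>)) (q + \<delta> + (K - lam) + \<epsilon> + (J - \<eta>)) s))"
  (is "_ = (\<Sum>\<eta>\<le>J. \<Sum>\<theta>\<le>J - \<eta>. \<Sum>lam\<le>K. \<Sum>\<mu>\<le>K - lam. ?f lam \<mu> \<eta> \<theta>)")
proof -
  have "app (A ^ \<kappa>) (app (B ^ J) (app (P ^ \<epsilon>) (app (C ^ K) (app (Q ^ \<delta>) (mon t r n p q s)))))
     = (\<Sum>lam\<le>K. \<Sum>\<mu>\<le>K - lam. \<Sum>\<eta>\<le>J. \<Sum>\<theta>\<le>J - \<eta>. ?f lam \<mu> \<eta> \<theta>)"
    by (simp only: Q_power_mon C_power_mon P_power_mon B_power_mon A_power_mon app_dist mult.assoc)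
  also have "\<dots> = (\<Sum>\<eta>\<le>J. \<Sum>\<theta>\<le>J - \<eta>. \<Sum>lam\<le>K. \<Sum>\<mu>\<le>K - lam. ?f lam \<mu> \<eta> \<theta>)"
    by (rule sum_swap_dependent)
  finally show ?thesis .
qed

end

section \<open>The product formula\<close>

text \<open>The left-hand side is the product of the coefficients as they arise from the successive expansions. Multinomials and falling
factorials split accordingly, and the signs agree because the difference of the exponents is even.\<close>

lemma coefficient_eq:
  fixes \<omega> :: "'f::field_char_0"
  assumes "\<alpha> \<le> j" "\<alpha> \<le> k" "\<beta> \<le> \<alpha>" "\<kappa> \<le> i" "\<delta> + \<epsilon> + \<zeta> \<le> i - \<kappa>" "\<epsilon> \<le> j - \<alpha>" "\<delta> \<le> k - \<alpha>"
    "\<eta> \<le> j - \<alpha> - \<epsilon>" "\<theta> \<le> j - \<alpha> - \<epsilon> - \<eta>" "lam \<le> k - \<alpha> - \<delta>" "\<mu> \<le> k - \<alpha> - \<delta> - lam"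
  defines "J \<equiv> j - \<alpha> - \<epsilon>" and "K \<equiv> k - \<alpha> - \<delta>"
  shows "of_nat (j choose \<alpha>) * falling_factorial k \<alpha> * (of_nat (\<alpha> choose \<beta>) * (- 1) ^ (\<alpha> - \<beta>))
     * (of_nat (i choose \<kappa>) * (of_nat (i - \<kappa> choose \<zeta>) * (- of_nat (\<alpha> - \<beta>)) ^ \<zeta> * ((- 1) ^ (i - \<kappa> - \<zeta> - (\<delta> + \<epsilon>))
        * of_nat (fact (\<delta> + \<epsilon>) * Stirling (i - \<kappa> - \<zeta>) (\<delta> + \<epsilon>)) * (of_nat (j - \<alpha> choose \<epsilon>) * of_nat (k - \<alpha> choose \<delta>)))))
     * (falling_factorial n \<delta> * (of_nat ((K choose lam) * (K - lam choose \<mu>)) * (- 1) ^ (K - lam) * falling_factorial (n - \<delta>) (K - lam))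
         * ((- 1) ^ \<epsilon> * falling_factorial (p + lam) \<epsilon>)
         * (of_nat ((J choose \<eta>) * (J - \<eta> choose \<theta>)) * (- 1) ^ (J - \<eta> - \<theta>) * falling_factorial (p + lam - \<epsilon>) (J - \<eta>))
         * (of_nat (r choose \<nu>) * \<omega> ^ \<nu>))
   = (-1) ^ (i + j + k + \<alpha> - \<beta> - \<kappa> - \<epsilon> - \<eta> - \<theta> - lam)
           * (of_nat \<alpha> - of_nat \<beta>) ^ \<zeta> * fact \<alpha> * of_nat (\<alpha> choose \<beta>) * fact (\<delta> + \<epsilon>) * \<omega> ^ \<nu>
           * multinomial i [\<kappa>, \<zeta>] * of_nat (Stirling (i - \<kappa> - \<zeta>) (\<delta> + \<epsilon>))
           * multinomial j [\<alpha>, \<epsilon>, \<eta>, \<theta>] * multinomial k [\<alpha>, \<delta>, lam, \<mu>]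
           * of_nat (r choose \<nu>)
           * falling_factorial n (k - \<alpha> - lam) * (falling_factorial (p + lam) (j - \<alpha> - \<eta>) :: 'f)"
proof -
  have mi: "multinomial i [\<kappa>, \<zeta>] = (of_nat (i choose \<kappa>) * of_nat (i - \<kappa> choose \<zeta>) :: 'f)"
    using assms by (simp add: multinomial_Cons multinomial_Nil)
  have mj: "multinomial j [\<alpha>, \<epsilon>, \<eta>, \<theta>] = (of_nat (j choose \<alpha>) * of_nat (j - \<alpha> choose \<epsilon>) * of_nat (J choose \<eta>)
      * of_nat (J - \<eta> choose \<theta>) :: 'f)"
    using assms by (simp add: multinomial_Cons multinomial_Nil)
  have mk: "multinomial k [\<alpha>, \<delta>, lam, \<mu>] = (of_nat (k choose \<alpha>) * of_nat (k - \<alpha> choose \<delta>) * of_nat (K choose lam)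
      * of_nat (K - lam choose \<mu>) :: 'f)"
    using assms by (simp add: multinomial_Cons multinomial_Nil)
  have fk: "(falling_factorial k \<alpha> :: 'f) = fact \<alpha> * of_nat (k choose \<alpha>)"
    using assms by (simp add: falling_factorial_binomial)
  have "\<delta> + (K - lam) = k - \<alpha> - lam" "\<epsilon> + (J - \<eta>) = j - \<alpha> - \<eta>"
    using assms by (simp_all add: J_def K_def)
  then have fn: "(falling_factorial n (k - \<alpha> - lam) :: 'f) = falling_factorial n \<delta> * falling_factorial (n - \<delta>) (K - lam)"
    and fp: "(falling_factorial (p + lam) (j - \<alpha> - \<eta>) :: 'f)
      = falling_factorial (p + lam) \<epsilon> * falling_factorial (p + lam - \<epsilon>) (J - \<eta>)"
    by (metis falling_factorial_add)+
  have g: "(- of_nat (\<alpha> - \<beta>) :: 'f) ^ \<zeta> = (- 1) ^ \<zeta> * (of_nat \<alpha> - of_nat \<beta>) ^ \<zeta>"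
    using assms by (simp add: of_nat_diff power_mult_distrib[symmetric])
  \<comment> \<open>Expressing all variables through the differences removes truncated subtraction from the parity claim.\<close>
  define a b c d e where "a = \<alpha> - \<beta>" and "b = i - \<kappa> - \<zeta> - (\<delta> + \<epsilon>)" and "c = K - lam" and "d = J - \<eta> - \<theta>"
    and "e = i + j + k + \<alpha> - \<beta> - \<kappa> - \<epsilon> - \<eta> - \<theta> - lam"
  have split: "i = \<kappa> + \<zeta> + \<delta> + \<epsilon> + b" "k = \<alpha> + \<delta> + lam + c" "j = \<alpha> + \<epsilon> + \<eta> + \<theta> + d"
    and \<alpha>: "\<alpha> = \<beta> + a"
    using assms by (simp_all add: a_def b_def c_def d_def)
  have "e + (\<beta> + \<kappa> + \<epsilon> + \<eta> + \<theta> + lam) = i + j + k + \<alpha>"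
    using assms by (simp add: e_def)
  then have "e + (a + \<zeta> + b + c + \<epsilon> + d) = 2 * (\<alpha> + a + \<zeta> + \<delta> + \<epsilon> + b + c + d)"
    unfolding split unfolding \<alpha> by simp
  then have "even (e + (a + \<zeta> + b + c + \<epsilon> + d))" by simp
  then have sgn: "(- 1 :: 'f) ^ e = (- 1) ^ a * (- 1) ^ \<zeta> * (- 1) ^ b * (- 1) ^ c * (- 1) ^ \<epsilon> * (- 1) ^ d"
    unfolding power_add[symmetric] by (rule minus_one_power_cong)
  show ?thesis
    unfolding mi mj mk fk fn fp g
    unfolding a_def[symmetric] b_def[symmetric] c_def[symmetric] d_def[symmetric] e_def[symmetric] sgn
    by (simp only: of_nat_mult of_nat_fact mult.assoc mult.commute mult.left_commute)
qed

context env_M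
begin

theorem mul_mon:
  "mul (mon 0 i j k l m) (mon 0 r n p q s) =
    (\<Sum>\<alpha>\<in>{0..min j k}. \<Sum>\<beta>\<in>{0..\<alpha>}. \<Sum>\<kappa>\<in>{0..i}. \<Sum>\<delta>\<in>{0..i - \<kappa>}. \<Sum>\<epsilon>\<in>{0..i - \<kappa> - \<delta>}. \<Sum>\<zeta>\<in>{0..i - \<kappa> - \<delta> - \<epsilon>}.
     \<Sum>\<eta>\<in>{\<eta>. int \<eta> \<le> int j - int \<alpha> - int \<epsilon>}.
     \<Sum>\<theta>\<in>{\<theta>. int \<theta> \<le> int j - int \<alpha> - int \<epsilon> - int \<eta>}.
     \<Sum>lam\<in>{lam. int lam \<le> int k - int \<alpha> - int \<delta>}.
     \<Sum>\<mu>\<in>{\<mu>. int \<mu> \<le> int k - int \<alpha> - int \<delta> - int lam}.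
     \<Sum>\<nu>\<in>{0..r}.
       scal (let \<omega> = of_nat j + of_nat k - of_nat l - 2 * of_nat \<alpha> - of_nat \<beta> - 2 * of_nat \<delta>
                - 2 * of_nat \<epsilon> - 2 * of_nat \<theta> - 2 * of_nat \<mu> - of_nat m * \<gamma>
        in (-1) ^ (i + j + k + \<alpha> - \<beta> - \<kappa> - \<epsilon> - \<eta> - \<theta> - lam)
           * (of_nat \<alpha> - of_nat \<beta>) ^ \<zeta> * fact \<alpha> * of_nat (\<alpha> choose \<beta>) * fact (\<delta> + \<epsilon>) * \<omega> ^ \<nu>
           * multinomial i [\<kappa>, \<zeta>] * of_nat (Stirling (i - \<kappa> - \<zeta>) (\<delta> + \<epsilon>))
           * multinomial j [\<alpha>, \<epsilon>, \<eta>, \<theta>] * multinomial k [\<alpha>, \<delta>, lam, \<mu>]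
           * of_nat (r choose \<nu>)
           * falling_factorial n (k - \<alpha> - lam) * falling_factorial (p + lam) (j - \<alpha> - \<eta>))
       (mon 0 (r + \<kappa> - \<nu>) (n + \<alpha> + \<eta> + lam - k) (p + \<alpha> + \<eta> + lam - j)
             (j + k + l + q - \<alpha> - \<eta> - lam) (m + s)))"
    (is "_ = (\<Sum>\<alpha>\<in>_. \<Sum>\<beta>\<in>_. \<Sum>\<kappa>\<in>_. \<Sum>\<delta>\<in>_. \<Sum>\<epsilon>\<in>_. \<Sum>\<zeta>\<in>_. \<Sum>\<eta>\<in>_. \<Sum>\<theta>\<in>_. \<Sum>lam\<in>_. \<Sum>\<mu>\<in>_. \<Sum>\<nu>\<in>_.
      ?t \<alpha> \<beta> \<kappa> \<delta> \<epsilon> \<zeta> \<eta> \<theta> lam \<mu> \<nu>)")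
proof -
  define c1 :: "nat \<Rightarrow> nat \<Rightarrow> 'f" where
    "c1 \<alpha> \<beta> = of_nat (j choose \<alpha>) * falling_factorial k \<alpha> * (of_nat (\<alpha> choose \<beta>) * (- 1) ^ (\<alpha> - \<beta>))" for \<alpha> \<beta>
  define c2 :: "nat \<Rightarrow> nat \<Rightarrow> nat \<Rightarrow> nat \<Rightarrow> nat \<Rightarrow> nat \<Rightarrow> 'f" where
    "c2 \<alpha> \<beta> \<kappa> \<delta> \<epsilon> \<zeta> = of_nat (i choose \<kappa>) * (of_nat (i - \<kappa> choose \<zeta>) * (- of_nat (\<alpha> - \<beta>)) ^ \<zeta> * ((- 1) ^ (i - \<kappa> - \<zeta> - (\<delta> + \<epsilon>))
        * of_nat (fact (\<delta> + \<epsilon>) * Stirling (i - \<kappa> - \<zeta>) (\<delta> + \<epsilon>)) * (of_nat (j - \<alpha> choose \<epsilon>) * of_nat (k - \<alpha> choose \<delta>))))"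
    for \<alpha> \<beta> \<kappa> \<delta> \<epsilon> \<zeta>
  define u where "u \<alpha> \<beta> \<kappa> \<delta> \<epsilon> = app (A ^ \<kappa>) (app (B ^ (j - \<alpha> - \<epsilon>)) (app (P ^ \<epsilon>) (app (C ^ (k - \<alpha> - \<delta>)) (app (Q ^ \<delta>)
      (mon (0 - of_nat m * \<gamma> - of_nat l - of_nat \<beta>) r n p (q + l + \<beta> + (\<alpha> - \<beta>)) (s + m))))))" for \<alpha> \<beta> \<kappa> \<delta> \<epsilon>
  have "mul (mon 0 i j k l m) (mon 0 r n p q s) = (\<Sum>\<alpha>\<le>j. \<Sum>\<beta>\<le>\<alpha>. \<Sum>\<kappa>\<le>i. \<Sum>\<delta>\<le>i - \<kappa>. \<Sum>\<epsilon>\<le>i - \<kappa> - \<delta>. \<Sum>\<zeta>\<le>i - \<kappa> - \<delta> - \<epsilon>.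
      scal (c1 \<alpha> \<beta> * c2 \<alpha> \<beta> \<kappa> \<delta> \<epsilon> \<zeta>) (u \<alpha> \<beta> \<kappa> \<delta> \<epsilon>))"
    unfolding mul_mon_Phi Phi_A_expand[OF comm_RA_weight] nilpotent_word_mon c1_def[symmetric] u_def[symmetric] c2_def[symmetric]
      vec.scale_sum_right scal_scal ..
  \<comment> \<open>For \<open>\<alpha> > k\<close> the falling factorial in \<open>c1\<close> vanishes.\<close>
  also have "\<dots> = (\<Sum>\<alpha>\<in>{0..min j k}. \<Sum>\<beta>\<in>{0..\<alpha>}. \<Sum>\<kappa>\<in>{0..i}. \<Sum>\<delta>\<in>{0..i - \<kappa>}. \<Sum>\<epsilon>\<in>{0..i - \<kappa> - \<delta>}. \<Sum>\<zeta>\<in>{0..i - \<kappa> - \<delta> - \<epsilon>}.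
      scal (c1 \<alpha> \<beta> * c2 \<alpha> \<beta> \<kappa> \<delta> \<epsilon> \<zeta>) (u \<alpha> \<beta> \<kappa> \<delta> \<epsilon>))"
    unfolding atLeast0AtMost
  proof (rule sum.mono_neutral_right, simp, simp, rule ballI)
    fix \<alpha> assume "\<alpha> \<in> {..j} - {..min j k}"
    then have "c1 \<alpha> \<beta> = 0" for \<beta> by (auto simp: c1_def falling_factorial_zero not_le)
    then show "(\<Sum>\<beta>\<le>\<alpha>. \<Sum>\<kappa>\<le>i. \<Sum>\<delta>\<le>i - \<kappa>. \<Sum>\<epsilon>\<le>i - \<kappa> - \<delta>. \<Sum>\<zeta>\<le>i - \<kappa> - \<delta> - \<epsilon>.
      scal (c1 \<alpha> \<beta> * c2 \<alpha> \<beta> \<kappa> \<delta> \<epsilon> \<zeta>) (u \<alpha> \<beta> \<kappa> \<delta> \<epsilon>)) = 0"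
      by (simp add: scal_zero_left)
  qed
  also have "\<dots> = (\<Sum>\<alpha>\<in>{0..min j k}. \<Sum>\<beta>\<in>{0..\<alpha>}. \<Sum>\<kappa>\<in>{0..i}. \<Sum>\<delta>\<in>{0..i - \<kappa>}. \<Sum>\<epsilon>\<in>{0..i - \<kappa> - \<delta>}. \<Sum>\<zeta>\<in>{0..i - \<kappa> - \<delta> - \<epsilon>}.
     \<Sum>\<eta>\<in>{\<eta>. int \<eta> \<le> int j - int \<alpha> - int \<epsilon>}.
     \<Sum>\<theta>\<in>{\<theta>. int \<theta> \<le> int j - int \<alpha> - int \<epsilon> - int \<eta>}.
     \<Sum>lam\<in>{lam. int lam \<le> int k - int \<alpha> - int \<delta>}.
     \<Sum>\<mu>\<in>{\<mu>. int \<mu> \<le> int k - int \<alpha> - int \<delta> - int lam}.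
     \<Sum>\<nu>\<in>{0..r}. ?t \<alpha> \<beta> \<kappa> \<delta> \<epsilon> \<zeta> \<eta> \<theta> lam \<mu> \<nu>)"
  proof (intro sum.cong refl)
    fix \<alpha> \<beta> \<kappa> \<delta> \<epsilon> \<zeta>
    assume "\<alpha> \<in> {0..min j k}" "\<beta> \<in> {0..\<alpha>}" "\<kappa> \<in> {0..i}" "\<delta> \<in> {0..i - \<kappa>}" "\<epsilon> \<in> {0..i - \<kappa> - \<delta>}" "\<zeta> \<in> {0..i - \<kappa> - \<delta> - \<epsilon>}"
    then have b: "\<alpha> \<le> j" "\<alpha> \<le> k" "\<beta> \<le> \<alpha>" "\<kappa> \<le> i" "\<delta> + \<epsilon> + \<zeta> \<le> i - \<kappa>" by auto
    show "scal (c1 \<alpha> \<beta> * c2 \<alpha> \<beta> \<kappa> \<delta> \<epsilon> \<zeta>) (u \<alpha> \<beta> \<kappa> \<delta> \<epsilon>) = (\<Sum>\<eta>\<in>{\<eta>. int \<eta> \<le> int j - int \<alpha> - int \<epsilon>}.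
     \<Sum>\<theta>\<in>{\<theta>. int \<theta> \<le> int j - int \<alpha> - int \<epsilon> - int \<eta>}.
     \<Sum>lam\<in>{lam. int lam \<le> int k - int \<alpha> - int \<delta>}.
     \<Sum>\<mu>\<in>{\<mu>. int \<mu> \<le> int k - int \<alpha> - int \<delta> - int lam}.
     \<Sum>\<nu>\<in>{0..r}. ?t \<alpha> \<beta> \<kappa> \<delta> \<epsilon> \<zeta> \<eta> \<theta> lam \<mu> \<nu>)"
    proof (cases "\<epsilon> \<le> j - \<alpha> \<and> \<delta> \<le> k - \<alpha>")
      \<comment> \<open>The range of \<open>\<eta>\<close> or of \<open>lam\<close> is empty, and a binomial coefficient in \<open>c2\<close> is zero.\<close>
      case False
      then have "int j - int \<alpha> - int \<epsilon> < 0 \<or> int k - int \<alpha> - int \<delta> < 0" using b by linarith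
      then have "{\<eta>. int \<eta> \<le> int j - int \<alpha> - int \<epsilon>} = {} \<or> {lam. int lam \<le> int k - int \<alpha> - int \<delta>} = {}" by auto
      moreover have "c2 \<alpha> \<beta> \<kappa> \<delta> \<epsilon> \<zeta> = 0" using False by (auto simp: c2_def)
      ultimately show ?thesis by (auto simp: scal_zero_left)
    next
      case True
      then have \<epsilon>: "\<epsilon> \<le> j - \<alpha>" and \<delta>: "\<delta> \<le> k - \<alpha>" by auto
      have sets: "{\<eta>. int \<eta> \<le> int j - int \<alpha> - int \<epsilon>} = {..j - \<alpha> - \<epsilon>}"
        "{lam. int lam \<le> int k - int \<alpha> - int \<delta>} = {..k - \<alpha> - \<delta>}"
        "\<And>\<eta>. \<eta> \<in> {..j - \<alpha> - \<epsilon>} \<Longrightarrow> {\<theta>. int \<theta> \<le> int j - int \<alpha> - int \<epsilon> - int \<eta>} = {..j - \<alpha> - \<epsilon> - \<eta>}"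
        "\<And>lam. lam \<in> {..k - \<alpha> - \<delta>} \<Longrightarrow> {\<mu>. int \<mu> \<le> int k - int \<alpha> - int \<delta> - int lam} = {..k - \<alpha> - \<delta> - lam}"
        using \<epsilon> \<delta> b by auto
      show ?thesis
        unfolding sets(1,2) u_def ABPCQ_word_mon vec.scale_sum_right scal_scal atLeast0AtMost
      proof (intro sum.cong sets(3,4)[symmetric] refl)
        fix \<eta> \<theta> lam \<mu> \<nu>
        assume \<eta>: "\<eta> \<in> {..j - \<alpha> - \<epsilon>}" and "\<theta> \<in> {\<theta>. int \<theta> \<le> int j - int \<alpha> - int \<epsilon> - int \<eta>}"
          and lam: "lam \<in> {..k - \<alpha> - \<delta>}" and "\<mu> \<in> {\<mu>. int \<mu> \<le> int k - int \<alpha> - int \<delta> - int lam}"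
          and \<nu>: "\<nu> \<in> {..r}"
        then have b': "\<eta> \<le> j - \<alpha> - \<epsilon>" "\<theta> \<le> j - \<alpha> - \<epsilon> - \<eta>" "lam \<le> k - \<alpha> - \<delta>" "\<mu> \<le> k - \<alpha> - \<delta> - lam"
          using sets(3)[OF \<eta>] sets(4)[OF lam] by auto
        define \<omega> :: 'f where "\<omega> = of_nat j + of_nat k - of_nat l - 2 * of_nat \<alpha> - of_nat \<beta> - 2 * of_nat \<delta>
                - 2 * of_nat \<epsilon> - 2 * of_nat \<theta> - 2 * of_nat \<mu> - of_nat m * \<gamma>"
        have \<omega>: "0 - of_nat m * \<gamma> - of_nat l - of_nat \<beta> - of_nat \<delta> + of_nat (k - \<alpha> - \<delta>) - 2 * of_nat \<mu> - of_nat \<epsilon>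
            + of_nat (j - \<alpha> - \<epsilon>) - 2 * of_nat \<theta> = \<omega>"
          using b \<epsilon> \<delta> by (simp add: \<omega>_def of_nat_diff)
        \<comment> \<open>Truncated subtraction gives the same exponents unless a falling factorial vanishes.\<close>
        have idx: "mon 0 (r + \<kappa> - \<nu>) (n - \<delta> - (k - \<alpha> - \<delta> - lam) + \<eta>) (p + lam - \<epsilon> - (j - \<alpha> - \<epsilon> - \<eta>))
              (q + l + \<beta> + (\<alpha> - \<beta>) + \<delta> + (k - \<alpha> - \<delta> - lam) + \<epsilon> + (j - \<alpha> - \<epsilon> - \<eta>)) (s + m)
            = mon 0 (r + \<kappa> - \<nu>) (n + \<alpha> + \<eta> + lam - k) (p + \<alpha> + \<eta> + lam - j) (j + k + l + q - \<alpha> - \<eta> - lam) (m + s)"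
          if "k - \<alpha> - lam \<le> n" "j - \<alpha> - \<eta> \<le> p + lam"
        proof -
          define a j' k' where "a = \<alpha> - \<beta>" and "j' = j - \<alpha> - \<epsilon> - \<eta>" and "k' = k - \<alpha> - \<delta> - lam"
          have j: "j = \<alpha> + \<epsilon> + \<eta> + j'" and k: "k = \<alpha> + \<delta> + lam + k'" and \<alpha>: "\<alpha> = \<beta> + a"
            using b b' \<epsilon> \<delta> by (simp_all add: a_def j'_def k'_def)
          have "\<delta> + k' \<le> n" "\<epsilon> + j' \<le> p + lam"
            using that by (simp_all add: j k)
          then have "n - \<delta> - k' + \<eta> = n + \<alpha> + \<eta> + lam - k" "p + lam - \<epsilon> - j' = p + \<alpha> + \<eta> + lam - j"
            by (simp_all add: j k)
          moreover have "q + l + \<beta> + a + \<delta> + k' + \<epsilon> + j' = j + k + l + q - \<alpha> - \<eta> - lam"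
            by (simp add: j k \<alpha>)
          ultimately have "n - \<delta> - (k - \<alpha> - \<delta> - lam) + \<eta> = n + \<alpha> + \<eta> + lam - k" "p + lam - \<epsilon> - (j - \<alpha> - \<epsilon> - \<eta>) = p + \<alpha> + \<eta> + lam - j"
            "q + l + \<beta> + (\<alpha> - \<beta>) + \<delta> + (k - \<alpha> - \<delta> - lam) + \<epsilon> + (j - \<alpha> - \<epsilon> - \<eta>) = j + k + l + q - \<alpha> - \<eta> - lam"
            unfolding a_def j'_def k'_def .
          then show ?thesis by (simp only: add.commute[of s m])
        qed
        have zero: "falling_factorial n (k - \<alpha> - lam) * (falling_factorial (p + lam) (j - \<alpha> - \<eta>) :: 'f) = 0"
          if "\<not> (k - \<alpha> - lam \<le> n \<and> j - \<alpha> - \<eta> \<le> p + lam)"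
          using that by (auto simp: falling_factorial_zero)
        show "scal (c1 \<alpha> \<beta> * c2 \<alpha> \<beta> \<kappa> \<delta> \<epsilon> \<zeta> *
           (falling_factorial n \<delta> * (of_nat ((k - \<alpha> - \<delta> choose lam) * (k - \<alpha> - \<delta> - lam choose \<mu>)) * (- 1) ^ (k - \<alpha> - \<delta> - lam) * falling_factorial (n - \<delta>) (k - \<alpha> - \<delta> - lam))
         * ((- 1) ^ \<epsilon> * falling_factorial (p + lam) \<epsilon>)
         * (of_nat ((j - \<alpha> - \<epsilon> choose \<eta>) * (j - \<alpha> - \<epsilon> - \<eta> choose \<theta>)) * (- 1) ^ (j - \<alpha> - \<epsilon> - \<eta> - \<theta>) * falling_factorial (p + lam - \<epsilon>) (j - \<alpha> - \<epsilon> - \<eta>))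
         * (of_nat (r choose \<nu>) * (0 - of_nat m * \<gamma> - of_nat l - of_nat \<beta> - of_nat \<delta> + of_nat (k - \<alpha> - \<delta>) - 2 * of_nat \<mu> - of_nat \<epsilon>
            + of_nat (j - \<alpha> - \<epsilon>) - 2 * of_nat \<theta>) ^ \<nu>)))
          (mon 0 (r + \<kappa> - \<nu>) (n - \<delta> - (k - \<alpha> - \<delta> - lam) + \<eta>) (p + lam - \<epsilon> - (j - \<alpha> - \<epsilon> - \<eta>))
              (q + l + \<beta> + (\<alpha> - \<beta>) + \<delta> + (k - \<alpha> - \<delta> - lam) + \<epsilon> + (j - \<alpha> - \<epsilon> - \<eta>)) (s + m))
          = ?t \<alpha> \<beta> \<kappa> \<delta> \<epsilon> \<zeta> \<eta> \<theta> lam \<mu> \<nu>"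
          unfolding \<omega> c1_def c2_def coefficient_eq[OF b \<epsilon> \<delta> b'] Let_def \<omega>_def[symmetric]
          using idx zero by (cases "k - \<alpha> - lam \<le> n \<and> j - \<alpha> - \<eta> \<le> p + lam") (auto simp: mult.assoc scal_zero_left)
      qed
    qed
  qed
  finally show ?thesis .
qed

end

section \<open>The quotient of the free nonassociative algebra\<close>

lemma lin_ext_superset:
  assumes "finite U" "Poly_Mapping.keys p \<subseteq> U"
  shows "lin_ext T p = (\<Sum>u\<in>U. scal (Poly_Mapping.lookup p u) (T u))"
  unfolding lin_ext_def
  by (rule sum.mono_neutral_left) (use assms in \<open>auto simp: in_keys_iff scal_zero_left\<close>)

lemma lin_ext_add: "lin_ext T (p + q) = lin_ext T p + lin_ext T q"
proof -
  let ?U = "Poly_Mapping.keys p \<union> Poly_Mapping.keys q"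
  have "Poly_Mapping.keys (p + q) \<subseteq> ?U" by (rule keys_add)
  then show ?thesis
    by (simp add: lin_ext_superset[of ?U] lookup_add scal_add_left sum.distrib)
qed

lemma lin_ext_scal: "lin_ext T (scal c p) = scal c (lin_ext T p)"
proof -
  have "Poly_Mapping.keys (scal c p) \<subseteq> Poly_Mapping.keys p" by (auto simp: in_keys_iff)
  then have "lin_ext T (scal c p) = (\<Sum>u\<in>Poly_Mapping.keys p. scal c (scal (Poly_Mapping.lookup p u) (T u)))"
    by (simp add: lin_ext_superset[of "Poly_Mapping.keys p"] scal_scal)
  then show ?thesis by (simp only: lin_ext_def vec.scale_sum_right)
qed

lemma lin_ext_single: "lin_ext T (Poly_Mapping.single u 1) = T u"
  by (simp add: lin_ext_def scal_one)

lemma bilin_ext_right: "bilin_ext T p q = lin_ext (\<lambda>v. lin_ext (\<lambda>u. T u v) p) q"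
  unfolding bilin_ext_def lin_ext_def vec.scale_sum_right scal_scal
  by (subst sum.swap) (simp only: mult.commute)

lemma bilin_ext_left: "bilin_ext T p q = lin_ext (\<lambda>u. lin_ext (T u) q) p"
  unfolding bilin_ext_def lin_ext_def vec.scale_sum_right scal_scal ..

lemma basis_expansion:
  fixes p :: "'x \<Rightarrow>\<^sub>0 'f::field"
  shows "lin_ext (\<lambda>u. Poly_Mapping.single u 1) p = p"
proof (rule poly_mapping_eqI)
  fix z
  show "Poly_Mapping.lookup (lin_ext (\<lambda>u. Poly_Mapping.single u 1) p) z = Poly_Mapping.lookup p z"
    by (simp add: lin_ext_def lookup_sum lookup_single when_def if_distrib[of "(*) _"] in_keys_iff
        sum.delta cong: if_cong)
qed

lemma fmul_add_left: "fmul (x + y) z = fmul x z + fmul y z"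
  and fmul_scal_left: "fmul (scal c x) z = scal c (fmul x z)"
  by (simp_all only: fmul_def bilin_ext_left lin_ext_add lin_ext_scal)

lemma fmul_add_right: "fmul z (x + y) = fmul z x + fmul z y"
  and fmul_scal_right: "fmul z (scal c x) = scal c (fmul z x)"
  by (simp_all only: fmul_def bilin_ext_right lin_ext_add lin_ext_scal)

lemma fmul_single: "fmul (Poly_Mapping.single u 1) (Poly_Mapping.single v 1) = Poly_Mapping.single (magma_mult u v) 1"
  by (simp only: fmul_def bilin_ext_left lin_ext_single)

lemma fmul_unit_left: "fmul (Poly_Mapping.single None 1) x = x"
  by (simp only: fmul_def bilin_ext_left lin_ext_single magma_mult.simps basis_expansion)

lemma fmul_unit_right: "fmul x (Poly_Mapping.single None 1) = x"
proof -
  have "magma_mult u None = u" for u :: "'a word option" by (cases u) simp_all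
  then show ?thesis by (simp only: fmul_def bilin_ext_right lin_ext_single basis_expansion)
qed

lemma fmul_minus_right: "fmul x (- y) = - fmul x y"
  using fmul_scal_right[of x "-1" y] by (simp add: scal_minus_left scal_one)

lemma fmul_minus_left: "fmul (- x) y = - fmul x y"
  using fmul_scal_left[of "-1" x y] by (simp add: scal_minus_left scal_one)

lemma fmul_diff_right: "fmul z (x - y) = fmul z x - fmul z y"
  using fmul_add_right[of z x "- y"] by (simp add: fmul_minus_right)

lemma fmul_diff_left: "fmul (x - y) z = fmul x z - fmul y z"
  using fmul_add_left[of x "- y" z] by (simp add: fmul_minus_left)

lemma emb_add: "emb (s + t) = emb s + emb t"
  and emb_scal: "emb (scal c s) = scal c (emb s)"
  and emb_single: "emb (Poly_Mapping.single g 1) = Poly_Mapping.single (Some (Gen g)) 1"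
  by (simp_all only: emb_def lin_ext_add lin_ext_scal lin_ext_single)

lemma two_sided_ideal_env: "two_sided_ideal (env_ideal br)"
  by (auto simp: env_ideal_def ideal_generated_def two_sided_ideal_def)

lemma env_subspace: "vec.subspace (env_ideal br)"
  using two_sided_ideal_env[of br] by (auto simp: two_sided_ideal_def vec.subspace_def)

lemma env_ideal_mult: "y \<in> env_ideal br \<Longrightarrow> fmul x y \<in> env_ideal br"
  "y \<in> env_ideal br \<Longrightarrow> fmul y x \<in> env_ideal br"
  using two_sided_ideal_env[of br] by (auto simp: two_sided_ideal_def)

lemma ideal_generated_superset: "S \<subseteq> ideal_generated S"
  by (auto simp: ideal_generated_def)

lemma env_ideal_gens:
  "fmul (emb s) (emb t) - fmul (emb t) (emb s) - emb (br s t) \<in> env_ideal br"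
  "associator (emb s) x y + associator x (emb s) y \<in> env_ideal br"
  "associator x (emb s) y + associator x y (emb s) \<in> env_ideal br"
  unfolding env_ideal_def by (rule subsetD[OF ideal_generated_superset], blast)+

text \<open>A complement of \<open>V\<close> provides the projection.\<close>

lemma projection_exists:
  fixes V :: "('x \<Rightarrow>\<^sub>0 'f::field) set"
  assumes "vec.subspace V"
  shows "\<exists>p. (\<forall>x y. p (x + y) = p x + p y) \<and> (\<forall>c x. p (scal c x) = scal c (p x)) \<and>
    (\<forall>x. x - p x \<in> V) \<and> (\<forall>x. p x = 0 \<longleftrightarrow> x \<in> V)"
proof -
  interpret vector_space_pair "scal :: 'f \<Rightarrow> ('x \<Rightarrow>\<^sub>0 'f) \<Rightarrow> _" "scal :: 'f \<Rightarrow> ('x \<Rightarrow>\<^sub>0 'f) \<Rightarrow> _"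
    by unfold_locales
  obtain g where g: "g ` UNIV \<subseteq> V" "Vector_Spaces.linear scal scal g" "\<forall>v\<in>V. g v = v"
    using linear_exists_left_inverse_on[OF vec.linear_id assms] by auto
  interpret g: Vector_Spaces.linear scal scal g by (rule g(2))
  have "x - g x = 0 \<longleftrightarrow> x \<in> V" for x using g(1,3) by auto
  then show ?thesis
    using g(1) by (intro exI[of _ "\<lambda>x. x - g x"]) (auto simp: g.add g.scale scal_diff_right)
qed

text \<open>A linear choice of representatives modulo the ideal, with \<open>0\<close> chosen exactly on the ideal.\<close>

definition reduce :: "(('x \<Rightarrow>\<^sub>0 'f::field) \<Rightarrow> ('x \<Rightarrow>\<^sub>0 'f) \<Rightarrow> ('x \<Rightarrow>\<^sub>0 'f)) \<Rightarrow> ('x, 'f) free_alg \<Rightarrow> ('x, 'f) free_alg"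
  where "reduce br = (SOME p. (\<forall>x y. p (x + y) = p x + p y) \<and> (\<forall>c x. p (scal c x) = scal c (p x)) \<and>
    (\<forall>x. x - p x \<in> env_ideal br) \<and> (\<forall>x. p x = 0 \<longleftrightarrow> x \<in> env_ideal br))"

lemma reduce_add: "reduce br (x + y) = reduce br x + reduce br y"
  and reduce_scal: "reduce br (scal c x) = scal c (reduce br x)"
  and reduce_cong: "x - reduce br x \<in> env_ideal br"
  and reduce_eq_0: "reduce br x = 0 \<longleftrightarrow> x \<in> env_ideal br"
  using someI_ex[OF projection_exists[OF env_subspace[of br]]] unfolding reduce_def[symmetric] by auto

lemma reduce_diff: "reduce br (x - y) = reduce br x - reduce br y"
  by (metis add_diff_cancel diff_add_cancel reduce_add)

lemma reduce_eqI: "x - y \<in> env_ideal br \<Longrightarrow> reduce br x = reduce br y"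
  using reduce_diff[of br x y] by (simp add: reduce_eq_0[symmetric])

lemma reduce_reduce: "reduce br (reduce br x) = reduce br x"
  using reduce_eqI[OF reduce_cong] by metis

lemma reduce_fmul_right: "reduce br (fmul x (reduce br y)) = reduce br (fmul x y)"
  by (rule reduce_eqI[symmetric]) (simp only: fmul_diff_right[symmetric] env_ideal_mult reduce_cong)

lemma reduce_fmul_left: "reduce br (fmul (reduce br x) y) = reduce br (fmul x y)"
  by (rule reduce_eqI[symmetric]) (simp only: fmul_diff_left[symmetric] env_ideal_mult reduce_cong)

text \<open>Composing the product of the free algebra with a projection along the ideal turns congruences modulo the ideal into
equations; the image of the projection is a copy of the enveloping algebra.\<close>

lemma env_alg_reduce:
  fixes br :: "('m \<Rightarrow>\<^sub>0 'f::field_char_0) \<Rightarrow> ('m \<Rightarrow>\<^sub>0 'f) \<Rightarrow> ('m \<Rightarrow>\<^sub>0 'f)"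
  shows "env_alg (\<lambda>x y. reduce br (fmul x y)) (reduce br (Poly_Mapping.single None 1)) (\<lambda>s. reduce br (emb s)) br"
proof
  note r = reduce_fmul_right reduce_fmul_left reduce_reduce
  fix x y z :: "('m, 'f) free_alg" and c :: 'f and s t :: "'m \<Rightarrow>\<^sub>0 'f"
  show "reduce br (fmul (x + y) z) = reduce br (fmul x z) + reduce br (fmul y z)"
    "reduce br (fmul x (y + z)) = reduce br (fmul x y) + reduce br (fmul x z)"
    "reduce br (fmul (scal c x) y) = scal c (reduce br (fmul x y))"
    "reduce br (fmul x (scal c y)) = scal c (reduce br (fmul x y))"
    "reduce br (emb (s + t)) = reduce br (emb s) + reduce br (emb t)"
    "reduce br (emb (scal c s)) = scal c (reduce br (emb s))"
    by (simp_all only: fmul_add_left fmul_add_right fmul_scal_left fmul_scal_right reduce_add reduce_scal emb_add emb_scal)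
  show "reduce br (fmul (reduce br (emb s)) (reduce br (emb t))) - reduce br (fmul (reduce br (emb t)) (reduce br (emb s)))
      = reduce br (emb (br s t))"
    unfolding r reduce_diff[symmetric] by (rule reduce_eqI) (rule env_ideal_gens)
  have alt: "reduce br (associator (emb s) x y + associator x (emb s) y) = 0"
    "reduce br (associator x (emb s) y + associator x y (emb s)) = 0"
    unfolding reduce_eq_0 by (rule env_ideal_gens)+
  show "reduce br (fmul (reduce br (fmul (reduce br (emb s)) x)) y)
      - reduce br (fmul (reduce br (emb s)) (reduce br (fmul x y)))
      = - (reduce br (fmul (reduce br (fmul x (reduce br (emb s)))) y)
      - reduce br (fmul x (reduce br (fmul (reduce br (emb s)) y))))"
    "reduce br (fmul (reduce br (fmul x (reduce br (emb s)))) y)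
      - reduce br (fmul x (reduce br (fmul (reduce br (emb s)) y)))
      = - (reduce br (fmul (reduce br (fmul x y)) (reduce br (emb s)))
      - reduce br (fmul x (reduce br (fmul y (reduce br (emb s))))))"
    by (simp_all only: r eq_neg_iff_add_eq_0 alt[unfolded associator_def reduce_add reduce_diff])
  let ?one = "reduce br (Poly_Mapping.single None 1)"
  show "reduce br (fmul ?one ?one) = ?one"
    "reduce br (fmul ?one (reduce br (fmul x y))) = reduce br (fmul x y)"
    "reduce br (fmul x ?one) = reduce br (fmul ?one x)"
    "reduce br (fmul (reduce br (fmul ?one x)) y) = reduce br (fmul x y)"
    "reduce br (fmul x (reduce br (fmul ?one y))) = reduce br (fmul x y)"
    "reduce br (fmul ?one (reduce br (emb s))) = reduce br (emb s)"
    by (simp_all only: r fmul_unit_left fmul_unit_right)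
  fix S :: "('m, 'f) free_alg set"
  assume S: "vec.subspace S" "?one \<in> S" "\<And>s. reduce br (emb s) \<in> S"
    "\<And>x y. x \<in> S \<Longrightarrow> y \<in> S \<Longrightarrow> reduce br (fmul x y) \<in> S"
  have word: "reduce br (Poly_Mapping.single (Some t) 1) \<in> S" for t
  proof (induction t)
    case (Gen g)
    show ?case using S(3)[of "Poly_Mapping.single g 1"] by (simp only: emb_single)
  next
    case (Node t u)
    have "reduce br (Poly_Mapping.single (Some (Node t u)) 1)
        = reduce br (fmul (reduce br (Poly_Mapping.single (Some t) 1)) (reduce br (Poly_Mapping.single (Some u) 1)))"
      by (simp only: r fmul_single magma_mult.simps)
    then show ?case using S(4)[OF Node.IH] by simp
  qed
  have "reduce br (Poly_Mapping.single w 1) \<in> S" for w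
    by (cases w) (simp_all only: S(2) word)
  then have "lin_ext (\<lambda>w. reduce br (Poly_Mapping.single w 1)) x \<in> S"
    unfolding lin_ext_def by (intro vec.subspace_sum[OF S(1)] vec.subspace_scale[OF S(1)])
  moreover have "lin_ext (\<lambda>w. reduce br (Poly_Mapping.single w 1)) x = reduce br x"
  proof -
    have zero: "reduce br 0 = 0" using reduce_diff[of br 0 0] by simp
    have sum: "reduce br (sum f U) = (\<Sum>u\<in>U. reduce br (f u))" for f :: "'m word option \<Rightarrow> ('m, 'f) free_alg" and U
      by (induction U rule: infinite_finite_induct) (simp_all add: zero reduce_add)
    show ?thesis
      using arg_cong[OF basis_expansion[of x], of "reduce br"] by (simp only: lin_ext_def sum reduce_scal)
  qed
  ultimately show "reduce br (fmul ?one x) \<in> S" by (simp only: r fmul_unit_left)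
qed

abbreviation coset where "coset br x \<equiv> env_ideal br +>\<^bsub>free_nonassoc\<^esub> x"

lemma coset_eq: "coset br x = {y. y - x \<in> env_ideal br}"
  by (auto simp: a_r_coset_defs free_nonassoc_def intro: bexI[of _ "_ - x"])

lemma coset_cong: "coset br x = coset br y \<longleftrightarrow> x - y \<in> env_ideal br"
proof
  have "x \<in> coset br x" using vec.subspace_0[OF env_subspace[of br]] by (simp add: coset_eq)
  then show "coset br x = coset br y \<Longrightarrow> x - y \<in> env_ideal br" by (simp add: coset_eq)
  assume xy: "x - y \<in> env_ideal br"
  have "z - x \<in> env_ideal br \<longleftrightarrow> z - y \<in> env_ideal br" for z
    using vec.subspace_add[OF env_subspace xy, of "z - x"] vec.subspace_diff[OF env_subspace _ xy, of "z - y"]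
    by (auto simp: algebra_simps)
  then show "coset br x = coset br y" by (simp add: coset_eq)
qed

lemma env_simps:
  "carrier (env br) = range (coset br)"
  "mult (env br) = rcoset_mult free_nonassoc (env_ideal br)"
  "one (env br) = coset br (Poly_Mapping.single None 1)"
  "zero (env br) = env_ideal br"
  "add (env br) = set_add free_nonassoc"
  "smult (env br) c X = (\<Union>x\<in>X. coset br (scal c x))"
  by (auto simp: env_def FactRing_def ring.defs A_RCOSETS_def' free_nonassoc_def)

lemma coset_zero: "zero (env br) = coset br 0"
  by (simp add: env_simps coset_eq)

lemma UN_coset:
  assumes "\<And>x'. x' - x \<in> env_ideal br \<Longrightarrow> F x' = F x"
  shows "(\<Union>x'\<in>coset br x. F x') = F x"
proof -
  have "x \<in> coset br x" using vec.subspace_0[OF env_subspace[of br]] by (simp add: coset_eq)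
  moreover have "F x' = F x" if "x' \<in> coset br x" for x'
    by (rule assms) (use that in \<open>simp add: coset_eq\<close>)
  ultimately show ?thesis by blast
qed

lemma coset_mult: "coset br x \<otimes>\<^bsub>env br\<^esub> coset br y = coset br (fmul x y)"
proof -
  have "(\<Union>b\<in>coset br y. coset br (fmul a b)) = coset br (fmul a y)" for a
    by (rule UN_coset) (simp only: coset_cong fmul_diff_right[symmetric] env_ideal_mult)
  moreover have "(\<Union>a\<in>coset br x. coset br (fmul a y)) = coset br (fmul x y)"
    by (rule UN_coset) (simp only: coset_cong fmul_diff_left[symmetric] env_ideal_mult)
  moreover have "coset br x \<otimes>\<^bsub>env br\<^esub> coset br y = (\<Union>a\<in>coset br x. \<Union>b\<in>coset br y. coset br (fmul a b))"
    by (simp only: env_simps rcoset_mult_def) (simp add: free_nonassoc_def)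
  ultimately show ?thesis by simp
qed

lemma set_add_eq: "set_add free_nonassoc X Y = {x + y | x y. x \<in> X \<and> y \<in> Y}"
  by (auto simp: set_add_def' free_nonassoc_def)

lemma coset_add: "coset br x \<oplus>\<^bsub>env br\<^esub> coset br y = coset br (x + y)"
proof -
  have "a + b - (x + y) \<in> env_ideal br" if "a - x \<in> env_ideal br" "b - y \<in> env_ideal br" for a b
    using vec.subspace_add[OF env_subspace that] by (simp add: algebra_simps)
  moreover have "\<exists>a b. a - x \<in> env_ideal br \<and> b - y \<in> env_ideal br \<and> z = a + b"
    if "z - (x + y) \<in> env_ideal br" for z
    using that vec.subspace_0[OF env_subspace[of br]]
    by (intro exI[of _ "z - y"] exI[of _ y]) (simp add: algebra_simps)
  ultimately show ?thesis
    unfolding env_simps set_add_eq coset_eq by blast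
qed

lemma coset_smult: "c \<odot>\<^bsub>env br\<^esub> coset br x = coset br (scal c x)"
  unfolding env_simps
  by (rule UN_coset)
    (simp add: coset_cong scal_diff_right[symmetric] vec.subspace_scale[OF env_subspace])

lemma abelian_monoid_env: "abelian_monoid (env br)"
  by (rule abelian_monoidI)
    (auto simp: env_simps(1) coset_zero coset_add add_ac)

lemma coset_sum: "coset br (sum f U) = (\<Oplus>\<^bsub>env br\<^esub>u\<in>U. coset br (f u))"
proof (induction U rule: infinite_finite_induct)
  interpret abelian_monoid "env br" by (rule abelian_monoid_env)
  case (infinite U)
  then show ?case by (simp add: coset_zero finsum_infinite)
next
  interpret abelian_monoid "env br" by (rule abelian_monoid_env)
  case empty
  show ?case by (simp add: coset_zero)
next
  interpret abelian_monoid "env br" by (rule abelian_monoid_env)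
  case (insert u U)
  then show ?case
    by (simp add: coset_add[symmetric] finsum_insert env_simps(1) Pi_def)
qed

lemma coset_reduce: "coset br (reduce br x) = coset br x"
proof -
  have "x - reduce br x \<in> env_ideal br" by (rule reduce_cong)
  then have "coset br x = coset br (reduce br x)" by (simp only: coset_cong)
  then show ?thesis by simp
qed

theorem theorem6p7:
  fixes \<gamma> :: "'f::field_char_0"
    and i j k l m r n p q s :: nat
  assumes "\<gamma> \<noteq> 0"
  shows "left_tapped \<gamma> i j k l m \<otimes>\<^bsub>UM \<gamma>\<^esub> left_tapped \<gamma> r n p q s =
    (\<Oplus>\<^bsub>UM \<gamma>\<^esub>\<alpha>\<in>{0..min j k}.
     \<Oplus>\<^bsub>UM \<gamma>\<^esub>\<beta>\<in>{0..\<alpha>}.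
     \<Oplus>\<^bsub>UM \<gamma>\<^esub>\<kappa>\<in>{0..i}.
     \<Oplus>\<^bsub>UM \<gamma>\<^esub>\<delta>\<in>{0..i - \<kappa>}.
     \<Oplus>\<^bsub>UM \<gamma>\<^esub>\<epsilon>\<in>{0..i - \<kappa> - \<delta>}.
     \<Oplus>\<^bsub>UM \<gamma>\<^esub>\<zeta>\<in>{0..i - \<kappa> - \<delta> - \<epsilon>}.
     \<Oplus>\<^bsub>UM \<gamma>\<^esub>\<eta>\<in>{\<eta>. int \<eta> \<le> int j - int \<alpha> - int \<epsilon>}.
     \<Oplus>\<^bsub>UM \<gamma>\<^esub>\<theta>\<in>{\<theta>. int \<theta> \<le> int j - int \<alpha> - int \<epsilon> - int \<eta>}.
     \<Oplus>\<^bsub>UM \<gamma>\<^esub>lam\<in>{lam. int lam \<le> int k - int \<alpha> - int \<delta>}.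
     \<Oplus>\<^bsub>UM \<gamma>\<^esub>\<mu>\<in>{\<mu>. int \<mu> \<le> int k - int \<alpha> - int \<delta> - int lam}.
     \<Oplus>\<^bsub>UM \<gamma>\<^esub>\<nu>\<in>{0..r}.
       (let \<omega> = of_nat j + of_nat k - of_nat l - 2 * of_nat \<alpha> - of_nat \<beta> - 2 * of_nat \<delta>
                - 2 * of_nat \<epsilon> - 2 * of_nat \<theta> - 2 * of_nat \<mu> - of_nat m * \<gamma>
        in (-1) ^ (i + j + k + \<alpha> - \<beta> - \<kappa> - \<epsilon> - \<eta> - \<theta> - lam)
           * (of_nat \<alpha> - of_nat \<beta>) ^ \<zeta> * fact \<alpha> * of_nat (\<alpha> choose \<beta>) * fact (\<delta> + \<epsilon>) * \<omega> ^ \<nu>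
           * multinomial i [\<kappa>, \<zeta>] * of_nat (Stirling (i - \<kappa> - \<zeta>) (\<delta> + \<epsilon>))
           * multinomial j [\<alpha>, \<epsilon>, \<eta>, \<theta>] * multinomial k [\<alpha>, \<delta>, lam, \<mu>]
           * of_nat (r choose \<nu>)
           * falling_factorial n (k - \<alpha> - lam) * falling_factorial (p + lam) (j - \<alpha> - \<eta>))
       \<odot>\<^bsub>UM \<gamma>\<^esub> left_tapped \<gamma> (r + \<kappa> - \<nu>) (n + \<alpha> + \<eta> + lam - k) (p + \<alpha> + \<eta> + lam - j)
             (j + k + l + q - \<alpha> - \<eta> - lam) (m + s))"
proof -
  let ?br = "M_bracket \<gamma>"
  interpret M: env_M "\<lambda>x y. reduce ?br (fmul x y)" "reduce ?br (Poly_Mapping.single None 1)" "\<lambda>s. reduce ?br (emb s)" \<gamma>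
    unfolding env_M_def by (rule env_alg_reduce)
  have step: "left_mult_gen \<gamma> x (coset ?br u) = coset ?br (app (M.L (basis_vec x)) u)" for x u
    by (simp only: left_mult_gen_def env_incl_def coset_mult M.app_Lop coset_reduce)
      (simp only: coset_cong[symmetric] coset_reduce[of _ "fmul _ _", symmetric] reduce_fmul_left)
  have steps: "(left_mult_gen \<gamma> x ^^ N) (coset ?br u) = coset ?br (app (M.L (basis_vec x) ^ N) u)" for x N u
    by (induction N) (simp_all only: funpow.simps id_apply o_apply step power_0 power_Suc app_simps)
  have tapped: "left_tapped \<gamma> i j k l m = coset ?br (M.mon 0 i j k l m)" for i j k l m
    unfolding left_tapped_def env_simps
      coset_reduce[of _ "Poly_Mapping.single None 1", symmetric] steps M.mon_word M.L_defs ..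
  have "left_tapped \<gamma> i j k l m \<otimes>\<^bsub>UM \<gamma>\<^esub> left_tapped \<gamma> r n p q s
      = coset ?br (reduce ?br (fmul (M.mon 0 i j k l m) (M.mon 0 r n p q s)))"
    by (simp only: tapped coset_mult coset_reduce)
  then show ?thesis
    unfolding M.mul_mon coset_sum coset_smult[symmetric] tapped .
qed

end
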